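(* Consider $2\times 2$ fewnomial systems $F=(f_1,f_2)$ of type $(3,3)$, and let $P_F:=\mathrm{Newt}(f_1)+\mathrm{Newt}(f_2)$ (Minkowski sum). Then the maximal number of isolated roots of $F$ in the positive quadrant $\mathbb{R}^2_+$ is respectively $0$, $2$, or $4$, according as we restrict to those $F$ with $P_F$ a line segment, a triangle, or an $\ell$-gon with $\ell\in\{4,5\}$.
   Context: For $a=(a_1,\ldots,a_n)\in\mathbb{R}^n$ write $x^a:=x_1^{a_1}\cdots x_n^{a_n}$; a monomial term is $cx^a$ with $c\in\mathbb{R}\setminus\{0\}$. Exponents are arbitrary real vectors. $\mathbb{R}^2_+:=\{x\in\mathbb{R}^2 \mid x_1,x_2>0\}$. An $n$-variate $m$-nomial is a finite real linear combination of such $x^a$ with exactly $m$ monomial terms (i.e. $m$ distinct exponent vectors with nonzero coefficients). A $2\times 2$ fewnomial system of type $(3,3)$ is a pair $F=(f_1,f_2)$ of bivariate $3$-nomials (trinomials). An arc is a point or a homeomorphic image of the unit circle or of an (open, closed, or half-open) unit interval. A real root $\zeta$ of $F$ is isolated iff the only arc of real roots of $F$ containing $\zeta$ is $\zeta$ itself. For an $m$-nomial $f=\sum_{a\in A}c_ax^a$, $\mathrm{Supp}(f):=\{a\mid c_a\neq 0\}$ and its Newton polytope is $\mathrm{Newt}(f):=\mathrm{Conv}(\mathrm{Supp}(f))$, the convex hull. *)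

theory Defs
  imports "HOL-Analysis.Analysis" "HOL-Library.Poly_Mapping"
begin

definition pos_orthant :: "(real^'n) set"
  where "pos_orthant = {x. \<forall>i. 0 < x $ i}"

definition monom_at :: "real^'n \<Rightarrow> real^'n \<Rightarrow> real"
  where "monom_at a x = (\<Prod>i\<in>UNIV. (x $ i) powr (a $ i))"

text \<open>
  A real linear combination of monomials with arbitrary real exponent vectors is represented by
  its finitely supported coefficient function; its support is then \<^const>\<open>Poly_Mapping.keys\<close>.
  Since powr is only meaningful for positive bases, values are only ever used on
  the positive orthant.
\<close>

type_synonym 'n fewnomial = "(real^'n) \<Rightarrow>\<^sub>0 real"

definition fewnomial_eval :: "'n::finite fewnomial \<Rightarrow> real^'n \<Rightarrow> real"
  where "fewnomial_eval f x = (\<Sum>a\<in>Poly_Mapping.keys f. Poly_Mapping.lookup f a * monom_at a x)"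

definition nomial :: "nat \<Rightarrow> 'n::finite fewnomial \<Rightarrow> bool"
  where "nomial m f \<longleftrightarrow> card (Poly_Mapping.keys f) = m"

definition Newt :: "'n::finite fewnomial \<Rightarrow> (real^'n) set"
  where "Newt f = convex hull (Poly_Mapping.keys f)"

type_synonym system2 = "2 fewnomial \<times> 2 fewnomial"

definition has_type :: "nat \<times> nat \<Rightarrow> system2 \<Rightarrow> bool"
  where "has_type m F \<longleftrightarrow> nomial (fst m) (fst F) \<and> nomial (snd m) (snd F)"

text \<open>The plus sign here is the elementwise (Minkowski) sum of sets.\<close>

definition newton_sum :: "system2 \<Rightarrow> (real^2) set"
  where "newton_sum F = Newt (fst F) + Newt (snd F)"

definition pos_roots :: "system2 \<Rightarrow> (real^2) set"
  where "pos_roots F =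
    {x \<in> pos_orthant. fewnomial_eval (fst F) x = 0 \<and> fewnomial_eval (snd F) x = 0}"

text \<open>
  Not to be confused with the library's notion \<^const>\<open>arc\<close>, an injective path on the closed
  unit interval: here an arc is a set, and points, circles and non-closed arcs are included.
\<close>

definition arc_set :: "'a::topological_space set \<Rightarrow> bool"
  where "arc_set S \<longleftrightarrow>
    (\<exists>p. S = {p}) \<or>
    S homeomorphic sphere (0::real^2) 1 \<or>
    S homeomorphic {0<..<1::real} \<or>
    S homeomorphic {0..1::real} \<or>
    S homeomorphic {0..<1::real} \<or>
    S homeomorphic {0<..1::real}"

definition isolated_pos_roots :: "system2 \<Rightarrow> (real^2) set"
  where "isolated_pos_roots F =
    {z \<in> pos_roots F. \<forall>S. arc_set S \<and> S \<subseteq> pos_roots F \<and> z \<in> S \<longrightarrow> S = {z}}"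

text \<open>
  Finiteness is part of the bound because \<^const>\<open>card\<close> of an infinite set is 0;
  the second conjunct says that the bound is attained.
\<close>

definition max_isolated_pos_roots :: "system2 set \<Rightarrow> nat \<Rightarrow> bool"
  where "max_isolated_pos_roots \<F> N \<longleftrightarrow>
    (\<forall>F\<in>\<F>. finite (isolated_pos_roots F) \<and> card (isolated_pos_roots F) \<le> N) \<and>
    (\<exists>F\<in>\<F>. card (isolated_pos_roots F) = N)"

definition line_segment :: "(real^2) set \<Rightarrow> bool"
  where "line_segment P \<longleftrightarrow> (\<exists>a b. a \<noteq> b \<and> P = closed_segment a b)"

text \<open>A convex polygon (with nonempty interior) having exactly \<open>l\<close> vertices.\<close>

definition polygon :: "nat \<Rightarrow> (real^2) set \<Rightarrow> bool"
  where "polygon l P \<longleftrightarrow> polytope P \<and> aff_dim P = 2 \<and> card {v. v extreme_point_of P} = l"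

end

theory Submission
  imports Defs
begin

text \<open>
  In the coordinates \<open>u = ln x\<close> a monomial with exponent \<open>a\<close> becomes \<open>exp (a \<bullet> u)\<close>. The positive
  roots thus correspond, by a homeomorphism, to the common zeros of two exponential sums with three
  terms each, and linear coordinate changes are available. The shape of the Minkowski sum \<open>P\<close>
  matters because it forces coincidences between the edge directions of the two Newton polytopes.

  If \<open>P\<close> is a segment, both supports lie on parallel lines, both sums depend up to a nonzero factor
  on a single linear functional of \<open>u\<close>, and the roots fill whole lines
  (\<open>no_isolated_root_parallel\<close>).

  If \<open>P\<close> is two-dimensional and one support is collinear, one equation leaves at most two values for
  a linear functional of \<open>u\<close>, and for each of them the other equation has at most two solutions, by
  Descartes' bound for exponential sums (\<open>few_roots_one_collinear\<close>).

  In the remaining case both Newton polytopes are triangles. Without parallel edges their sum would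
  be a hexagon (\<open>six_vertices_if_no_parallel_edges\<close>), so for at most five vertices there is a pair of
  parallel edges. The system then takes the form \<open>c0 + c1 X + c2 Y = 0\<close>,
  \<open>d0 + d1 X\<^sup>\<mu> + d2 X\<^sup>p Y\<^sup>q = 0\<close>. The first equation makes \<open>Y\<close> an affine function of \<open>X\<close>, and two
  applications of Rolle's theorem reduce the second one to a quadratic equation. This leaves at most
  \<open>2 + 2\<close> roots unless the equation holds identically, and then the roots fill a curve and none is
  isolated (\<open>few_roots_parallel_edge\<close>). If \<open>P\<close> is itself a triangle, the two Newton triangles are
  homothetic (\<open>triangle_sum_homothetic\<close>), the quadratic equation has no positive solution unless it
  is trivial, and the bound drops to 2.

  Explicit systems with rational roots show that the bounds are attained.
\<close>

section \<open>Counting zeros by Rolle's theorem\<close>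

lemma rolle_root_count:
  fixes f f' :: "real \<Rightarrow> real"
  assumes I: "convex I"
    and der: "\<And>t. t \<in> I \<Longrightarrow> (f has_real_derivative f' t) (at t)"
    and fin: "finite {t \<in> I. f' t = 0}"
  shows "finite {t \<in> I. f t = 0} \<and> card {t \<in> I. f t = 0} \<le> Suc (card {t \<in> I. f' t = 0})"
proof -
  have seg: "z \<in> I" if "x \<in> I" "y \<in> I" "x \<le> z" "z \<le> y" for x y z
    using mem_is_interval_1_I is_interval_convex_1 I that by blast
  have *: "card S \<le> Suc (card {t \<in> I. f' t = 0})"
    if S: "finite S" "S \<subseteq> {t \<in> I. f t = 0}" for S
  proof (cases "S = {}")
    case False
    \<comment> \<open>Rolle points chosen between consecutive zeros are distinct, one for each zero but the last.\<close>
    define nxt where "nxt s = Min {u \<in> S. s < u}" for s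
    have nxt: "nxt s \<in> S \<and> s < nxt s \<and> (\<forall>u\<in>S. s < u \<longrightarrow> nxt s \<le> u)"
      if "s \<in> S - {Max S}" for s
    proof -
      have "s < Max S" using that S by (auto simp: less_le)
      hence "{u \<in> S. s < u} \<noteq> {}" using False S(1) Max_in by blast
      thus ?thesis unfolding nxt_def using S(1) Min_in[of "{u \<in> S. s < u}"] by auto
    qed
    have "\<exists>r. s < r \<and> r < nxt s \<and> r \<in> I \<and> f' r = 0" if "s \<in> S - {Max S}" for s
    proof -
      from nxt[OF that] that S have n: "s < nxt s" "nxt s \<in> I" "s \<in> I" "f s = f (nxt s)" by (auto simp: subset_iff)
      have "\<exists>z. s < z \<and> z < nxt s \<and> (*) (f' z) = (\<lambda>v. 0)"
      proof (rule Rolle_deriv[OF n(1) n(4)])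
        show "continuous_on {s..nxt s} f"
          by (intro continuous_at_imp_continuous_on ballI DERIV_isCont[OF der] seg[OF n(3) n(2)]) auto
      next
        fix x assume "s < x" "x < nxt s"
        thus "(f has_derivative (*) (f' x)) (at x)"
          using der[OF seg[OF n(3) n(2)]] by (simp add: has_field_derivative_def)
      qed
      then obtain z where z: "s < z" "z < nxt s" "(*) (f' z) = (\<lambda>v. 0)" by blast
      have "f' z = 0" using fun_cong[OF z(3), of 1] by simp
      thus ?thesis using z seg[OF n(3) n(2), of z] by auto
    qed
    then obtain r where r: "\<And>s. s \<in> S - {Max S} \<Longrightarrow> s < r s \<and> r s < nxt s \<and> r s \<in> I \<and> f' (r s) = 0"
      by metis
    have lt: "r s < r s'" if "s \<in> S - {Max S}" "s' \<in> S - {Max S}" "s < s'" for s s'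
      using r[OF that(1)] r[OF that(2)] nxt[OF that(1)] that by fastforce
    have "inj_on r (S - {Max S})"
      by (rule inj_onI) (metis lt less_irrefl linorder_neqE)
    moreover have "r ` (S - {Max S}) \<subseteq> {t \<in> I. f' t = 0}" using r by blast
    ultimately have "card (S - {Max S}) \<le> card {t \<in> I. f' t = 0}"
      using card_inj_on_le fin by blast
    thus ?thesis using S(1) by (simp add: card_Diff_singleton_if split: if_splits)
  qed simp
  have "finite {t \<in> I. f t = 0}"
  proof (rule ccontr)
    assume "infinite {t \<in> I. f t = 0}"
    then obtain S where "S \<subseteq> {t \<in> I. f t = 0}" "finite S" "card S = Suc (Suc (card {t \<in> I. f' t = 0}))"
      by (meson infinite_arbitrarily_large)
    with *[of S] show False by simp
  qed
  with * show ?thesis by blast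
qed

text \<open>
  Descartes' bound for real exponents: after division by one of the exponentials, that term
  becomes constant and differentiation removes it, so Rolle's theorem gives an induction on the
  number of terms.
\<close>
lemma exp_sum_root_count:
  fixes c :: "real \<Rightarrow> real"
  assumes "finite E" "\<exists>e\<in>E. c e \<noteq> 0"
  shows "finite {r. (\<Sum>e\<in>E. c e * exp (e * r)) = 0} \<and>
         card {r. (\<Sum>e\<in>E. c e * exp (e * r)) = 0} < card E"
  using assms
proof (induction "card E" arbitrary: E c)
  case 0
  thus ?case by simp
next
  case (Suc n)
  from Suc.prems obtain e0 where e0: "e0 \<in> E" "c e0 \<noteq> 0" by blast
  \<comment> \<open>Exponents and coefficients after division by \<open>exp (e0 * r)\<close> and differentiation.\<close>
  define E' where "E' = (\<lambda>e. e - e0) ` (E - {e0})"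
  define d where "d e = c (e + e0) * e" for e
  have cardE': "card E' = n" "finite E'"
    using Suc.hyps(2) e0 Suc.prems(1) unfolding E'_def by (auto simp: card_image inj_on_def)
  have E: "(\<Sum>e\<in>E. c e * exp (e * r)) = exp (e0 * r) * (c e0 + (\<Sum>e\<in>E'. c (e + e0) * exp (e * r)))" for r
    unfolding E'_def using Suc.prems(1) e0
    by (simp add: sum.reindex inj_on_def sum.remove[OF _ e0(1)] o_def algebra_simps sum_distrib_left exp_diff)
  define f where "f r = c e0 + (\<Sum>e\<in>E'. c (e + e0) * exp (e * r))" for r
  have eq: "{r. (\<Sum>e\<in>E. c e * exp (e * r)) = 0} = {r \<in> UNIV. f r = 0}"
    unfolding E f_def by simp
  show ?case
  proof (cases "\<exists>e\<in>E'. d e \<noteq> 0")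
    case True
    have der: "(f has_real_derivative (\<Sum>e\<in>E'. d e * exp (e * r))) (at r)" for r
      unfolding f_def d_def
      by (auto intro!: derivative_eq_intros sum.cong simp: algebra_simps)
    have "finite {r. (\<Sum>e\<in>E'. d e * exp (e * r)) = 0} \<and>
         card {r. (\<Sum>e\<in>E'. d e * exp (e * r)) = 0} < n"
      using Suc.hyps(1)[of E' d] cardE' True by simp
    with rolle_root_count[of UNIV f "\<lambda>r. \<Sum>e\<in>E'. d e * exp (e * r)"] der Suc.hyps(2)
    show ?thesis unfolding eq by auto
  next
    case False
    have "0 \<notin> E'" unfolding E'_def by auto
    with False have "c (e + e0) = 0" if "e \<in> E'" for e using that unfolding d_def by auto
    hence "f r = c e0" for r unfolding f_def by simp
    thus ?thesis unfolding eq using e0 Suc.hyps(2) by simp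
  qed
qed

lemma quadratic_root_count:
  fixes A B C :: real
  assumes "\<not> (A = 0 \<and> B = 0 \<and> C = 0)"
  shows "finite {t \<in> I. A * t\<^sup>2 + B * t + C = 0} \<and> card {t \<in> I. A * t\<^sup>2 + B * t + C = 0} \<le> 2"
proof -
  have s: "{t \<in> I. A * t\<^sup>2 + B * t + C = 0} \<subseteq> {t. poly [:C, B, A:] t = 0}"
    by (auto simp: algebra_simps power2_eq_square)
  have nz: "[:C, B, A:] \<noteq> 0" using assms by auto
  have "card {t. poly [:C, B, A:] t = 0} \<le> degree [:C, B, A:]" by (rule card_poly_roots_bound[OF nz])
  also have "\<dots> \<le> 2" by simp
  finally show ?thesis using s poly_roots_finite[OF nz] by (meson card_mono finite_subset le_trans)
qed

text \<open>
  The equation \<open>g t = 0\<close> is what remains of two trinomial equations sharing an edge direction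
  once one of the two variables has been eliminated. Two derivatives suffice to get rid of all
  real powers. The first one kills \<open>d0\<close>; divided by a nowhere vanishing power of \<open>t\<close> it reads
  \<open>h t = C\<close>, where \<open>h\<close> is a product of two powers and a linear polynomial. The second one kills
  \<open>C\<close> and leaves a positive function times the polynomial \<open>Q\<close>, of degree at most two. Each
  application of Rolle's theorem costs one root. If \<open>Q\<close> vanishes identically, then \<open>h\<close> is
  constant, so \<open>g\<close> is either constant or strictly monotone on the interval \<open>I\<close>.
\<close>
lemma eliminated_root_count:
  fixes \<alpha> \<beta> \<mu> p q d0 d1 d2 :: real
  defines "I \<equiv> {t. 0 < t \<and> 0 < \<alpha> + \<beta> * t}"
    and "g \<equiv> \<lambda>t. d0 + d1 * t powr \<mu> + d2 * (t powr p * (\<alpha> + \<beta> * t) powr q)"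
    and "Q \<equiv> \<lambda>t. (p - \<mu>) * (\<alpha> + \<beta> * t) * (p * \<alpha> + (p + q) * \<beta> * t)
               + (q - 1) * \<beta> * t * (p * \<alpha> + (p + q) * \<beta> * t) + (p + q) * \<beta> * t * (\<alpha> + \<beta> * t)"
  assumes d2: "d2 \<noteq> 0"
    and Q: "(\<forall>t. Q t = 0) \<or> finite {t \<in> I. Q t = 0} \<and> card {t \<in> I. Q t = 0} \<le> k"
  shows "(\<forall>t\<in>I. g t = 0) \<or> finite {t \<in> I. g t = 0} \<and> card {t \<in> I. g t = 0} \<le> k + 2"
proof -
  have I: "convex I"
  proof -
    have "I = {0<..} \<inter> {t. (- \<beta>) \<bullet> t < \<alpha>}" unfolding I_def by auto
    thus ?thesis by (metis convex_Int convex_halfspace_lt convex_real_interval(3))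
  qed
  define h where "h t = t powr (p - \<mu>) * (\<alpha> + \<beta> * t) powr (q - 1) * (p * \<alpha> + (p + q) * \<beta> * t)" for t
  define C where "C = - (d1 * \<mu>) / d2"
  define g' where "g' t = d2 * t powr (\<mu> - 1) * (h t - C)" for t
  define h' where "h' t = t powr (p - \<mu> - 1) * (\<alpha> + \<beta> * t) powr (q - 2) * Q t" for t
  have pw: "x powr (y - 1) = x powr y / x" "x powr (y - 2) = x powr y / (x * x)" if "x > 0" for x y :: real
    using that powr_diff[of x y 1] powr_diff[of x y 2]
    by (simp_all add: powr_numeral power2_eq_square)
  have dlin: "((\<lambda>t. \<alpha> + \<beta> * t) has_real_derivative \<beta>) (at t)" for t
    by (auto intro!: derivative_eq_intros)
  have dg: "(g has_real_derivative g' t) (at t)" if "t \<in> I" for t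
  proof -
    define w where "w = \<alpha> + \<beta> * t"
    have t: "t > 0" "w > 0" using that unfolding I_def w_def by auto
    have L: "p * \<alpha> + (p + q) * \<beta> * t = p * w + q * \<beta> * t" unfolding w_def by (simp add: algebra_simps)
    have "(g has_real_derivative d1 * (\<mu> * t powr (\<mu> - 1)) + d2 * (p * t powr (p - 1) * w powr q
            + q * w powr (q - 1) * \<beta> * t powr p)) (at t)"
      unfolding g_def w_def
      by (rule derivative_eq_intros refl has_real_derivative_powr dlin | use t in \<open>simp add: w_def\<close>; fail)+
    also have "d1 * (\<mu> * t powr (\<mu> - 1)) + d2 * (p * t powr (p - 1) * w powr q
            + q * w powr (q - 1) * \<beta> * t powr p) = g' t"
      unfolding g'_def h_def C_def L w_def[symmetric]
      using t d2 by (simp add: pw powr_diff[of t p \<mu>] field_simps)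
    finally show ?thesis .
  qed
  have dh: "((\<lambda>t. h t - C) has_real_derivative h' t) (at t)" if "t \<in> I" for t
  proof -
    define w where "w = \<alpha> + \<beta> * t"
    define L where "L = p * \<alpha> + (p + q) * \<beta> * t"
    have t: "t > 0" "w > 0" using that unfolding I_def w_def by auto
    have "((\<lambda>t. h t - C) has_real_derivative
            ((p - \<mu>) * t powr (p - \<mu> - 1) * w powr (q - 1)
             + (q - 1) * w powr (q - 1 - 1) * \<beta> * t powr (p - \<mu>)) * L
             + (p + q) * \<beta> * (t powr (p - \<mu>) * w powr (q - 1))) (at t)"
      unfolding h_def w_def L_def
      by (rule derivative_eq_intros refl has_real_derivative_powr dlin | use t in \<open>simp add: w_def\<close>; fail)+
    also have "((p - \<mu>) * t powr (p - \<mu> - 1) * w powr (q - 1)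
             + (q - 1) * w powr (q - 1 - 1) * \<beta> * t powr (p - \<mu>)) * L
             + (p + q) * \<beta> * (t powr (p - \<mu>) * w powr (q - 1)) = h' t"
      unfolding h'_def Q_def w_def[symmetric] L_def[symmetric] pw(2)[OF t(2)] pw(1)[OF t(2)] pw(1)[OF t(1)]
      using t by (simp add: divide_simps) (simp add: algebra_simps)
    finally show ?thesis .
  qed
  have const: "\<exists>c. \<forall>t\<in>I. f t = c" if "\<And>t. t \<in> I \<Longrightarrow> (f has_real_derivative 0) (at t)" for f
  proof -
    have "\<exists>c. \<forall>t\<in>I. f t = c"
      by (rule has_field_derivative_zero_constant[OF I])
         (use that has_field_derivative_at_within in blast)
    thus ?thesis .
  qed
  have g0: "g' t = 0 \<longleftrightarrow> h t - C = 0" if "t \<in> I" for t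
    using that d2 unfolding g'_def I_def by auto
  have h0: "h' t = 0 \<longleftrightarrow> Q t = 0" if "t \<in> I" for t
    using that unfolding h'_def I_def by auto
  have g'h: "{t \<in> I. g' t = 0} = {t \<in> I. h t - C = 0}" using g0 by blast
  have h'Q: "{t \<in> I. h' t = 0} = {t \<in> I. Q t = 0}" using h0 by blast
  have hroots: "(\<forall>t\<in>I. h t - C = 0) \<or> finite {t \<in> I. h t - C = 0} \<and> card {t \<in> I. h t - C = 0} \<le> k + 1"
    using Q
  proof
    assume "\<forall>t. Q t = 0"
    hence "((\<lambda>t. h t - C) has_real_derivative 0) (at t)" if "t \<in> I" for t
      using dh[OF that] h0[OF that] by simp
    then obtain c where "\<forall>t\<in>I. h t - C = c" using const[of "\<lambda>t. h t - C"] by blast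
    hence "(\<forall>t\<in>I. h t - C = 0) \<or> {t \<in> I. h t - C = 0} = {}" by auto
    thus ?thesis by (rule disj_forward) (assumption, simp only: card.empty finite.emptyI le0 simp_thms)
  next
    assume "finite {t \<in> I. Q t = 0} \<and> card {t \<in> I. Q t = 0} \<le> k"
    with rolle_root_count[OF I dh] show ?thesis unfolding h'Q by fastforce
  qed
  thus ?thesis
  proof
    assume "\<forall>t\<in>I. h t - C = 0"
    hence "(g has_real_derivative 0) (at t)" if "t \<in> I" for t
      using dg[OF that] g0[OF that] that by simp
    then obtain c where "\<forall>t\<in>I. g t = c" using const[of g] by blast
    hence "(\<forall>t\<in>I. g t = 0) \<or> {t \<in> I. g t = 0} = {}" by auto
    thus ?thesis by (rule disj_forward) (assumption, simp only: card.empty finite.emptyI le0 simp_thms)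
  next
    assume "finite {t \<in> I. h t - C = 0} \<and> card {t \<in> I. h t - C = 0} \<le> k + 1"
    with rolle_root_count[OF I dg] show ?thesis unfolding g'h by fastforce
  qed
qed

text \<open>
  Several indices may carry the same exponent, and their coefficients may then cancel. An index
  whose exponent is not shared guarantees that the sum obtained by collecting equal exponents is
  not zero.
\<close>
lemma exp_sum_root_count_indexed:
  fixes c k :: "'a \<Rightarrow> real"
  assumes A: "finite A" and a: "a \<in> A" "c a \<noteq> 0" "\<And>b. b \<in> A \<Longrightarrow> k b = k a \<Longrightarrow> b = a"
  shows "finite {r. (\<Sum>b\<in>A. c b * exp (k b * r)) = 0} \<and>
         card {r. (\<Sum>b\<in>A. c b * exp (k b * r)) = 0} < card A"
proof -
  define C where "C e = (\<Sum>b | b \<in> A \<and> k b = e. c b)" for e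
  have eq: "(\<Sum>b\<in>A. c b * exp (k b * r)) = (\<Sum>e\<in>k ` A. C e * exp (e * r))" for r
    unfolding sum.image_gen[OF A, of _ k] C_def sum_distrib_right
    by (intro sum.cong) auto
  have "{b \<in> A. k b = k a} = {a}" using a by auto
  hence "C (k a) \<noteq> 0" unfolding C_def using a(2) by simp
  hence "\<exists>e\<in>k ` A. C e \<noteq> 0" using a(1) by blast
  from exp_sum_root_count[OF _ this] A card_image_le[OF A, of k] show ?thesis
    unfolding eq by fastforce
qed

section \<open>Logarithmic coordinates and isolated roots\<close>

abbreviation supp :: "2 fewnomial \<Rightarrow> (real^2) set"
  where "supp \<equiv> Poly_Mapping.keys"

abbreviation cf :: "2 fewnomial \<Rightarrow> real^2 \<Rightarrow> real"
  where "cf \<equiv> Poly_Mapping.lookup"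

definition exp_vec :: "real^2 \<Rightarrow> real^2"
  where "exp_vec u = (\<chi> i. exp (u $ i))"

definition exp_eval :: "2 fewnomial \<Rightarrow> real^2 \<Rightarrow> real"
  where "exp_eval f u = (\<Sum>a\<in>supp f. cf f a * exp (a \<bullet> u))"

definition log_roots :: "system2 \<Rightarrow> (real^2) set"
  where "log_roots F = {u. exp_eval (fst F) u = 0 \<and> exp_eval (snd F) u = 0}"

lemma fewnomial_eval_exp_vec: "fewnomial_eval f (exp_vec u) = exp_eval f u"
proof -
  have "monom_at a (exp_vec u) = exp (a \<bullet> u)" for a
    unfolding monom_at_def exp_vec_def inner_vec_def
    by (simp add: powr_def exp_sum)
  thus ?thesis unfolding fewnomial_eval_def exp_eval_def by simp
qed

lemma inj_exp_vec: "inj exp_vec"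
  by (auto simp: inj_def exp_vec_def vec_eq_iff)

lemma continuous_on_exp_vec [continuous_intros]:
  "continuous_on S f \<Longrightarrow> continuous_on S (\<lambda>t. exp_vec (f t))"
  unfolding exp_vec_def by (intro continuous_intros)

lemma pos_orthant_eq_exp_vec: "pos_orthant = range exp_vec"
proof -
  have "x = exp_vec (\<chi> i. ln (x $ i))" if "x \<in> pos_orthant" for x :: "real^2"
    using that by (auto simp: pos_orthant_def exp_vec_def vec_eq_iff)
  moreover have "exp_vec u \<in> pos_orthant" for u by (auto simp: pos_orthant_def exp_vec_def)
  ultimately show ?thesis by blast
qed

lemma pos_roots_eq_exp_vec: "pos_roots F = exp_vec ` log_roots F"
  unfolding pos_roots_def log_roots_def pos_orthant_eq_exp_vec
  by (auto simp: fewnomial_eval_exp_vec)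

text \<open>
  By compactness an injective curve is a homeomorphism onto its image, which is thus an arc.
\<close>
lemma not_isolated_if_on_curve:
  fixes \<gamma> :: "real \<Rightarrow> real^2"
  assumes "0 < \<delta>" "continuous_on {-\<delta>..\<delta>} \<gamma>" "inj_on \<gamma> {-\<delta>..\<delta>}"
    "\<And>t. t \<in> {-\<delta>..\<delta>} \<Longrightarrow> \<gamma> t \<in> log_roots F"
  shows "exp_vec (\<gamma> 0) \<notin> isolated_pos_roots F"
proof
  assume iso: "exp_vec (\<gamma> 0) \<in> isolated_pos_roots F"
  define S where "S = (\<lambda>t. exp_vec (\<gamma> t)) ` {-\<delta>..\<delta>}"
  have inj: "inj_on (\<lambda>t. exp_vec (\<gamma> t)) {-\<delta>..\<delta>}"
    by (rule inj_onI) (blast dest: injD[OF inj_exp_vec] inj_onD[OF assms(3)])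
  have "{-\<delta>..\<delta>} homeomorphic S"
    unfolding S_def by (rule homeomorphic_compact[OF _ _ refl inj]) (auto intro: continuous_intros assms)
  moreover have "{-\<delta>..\<delta>} homeomorphic {0..1::real}"
    using homeomorphic_closed_intervals_real[of "-\<delta>" \<delta> 0 1] assms(1) by simp
  ultimately have "arc_set S"
    unfolding arc_set_def by (meson homeomorphic_sym homeomorphic_trans)
  moreover have "S \<subseteq> pos_roots F" unfolding S_def pos_roots_eq_exp_vec using assms(4) by auto
  moreover have z: "exp_vec (\<gamma> 0) \<in> S" "exp_vec (\<gamma> \<delta>) \<in> S" unfolding S_def using assms(1) by auto
  ultimately have "S = {exp_vec (\<gamma> 0)}" using iso unfolding isolated_pos_roots_def by blast
  with z(2) have "exp_vec (\<gamma> \<delta>) = exp_vec (\<gamma> 0)" by blast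
  thus False using inj_onD[OF inj, of \<delta> 0] assms(1) by auto
qed

text \<open>
  Every arc is connected, and a finite connected set has at most one point.
\<close>
lemma isolated_if_finite:
  assumes "finite (pos_roots F)"
  shows "isolated_pos_roots F = pos_roots F"
proof -
  have "S = {z}" if S: "arc_set S" "S \<subseteq> pos_roots F" "z \<in> S" for S z
  proof -
    have "connected S"
      using S(1) unfolding arc_set_def
      by (auto simp: homeomorphic_connectedness connected_sphere)
    moreover have "finite S" using S(2) assms finite_subset by blast
    ultimately show ?thesis using S(3) by (metis connected_finite_iff_sing empty_iff singletonD)
  qed
  thus ?thesis unfolding isolated_pos_roots_def by blast
qed

text \<open>
  The alternative that all upper bounds establish: when elimination leads to an identically
  vanishing function the roots fill curves and none is isolated, and otherwise even the number of
  all roots is bounded.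
\<close>
definition few_roots :: "nat \<Rightarrow> system2 \<Rightarrow> bool"
  where "few_roots N F \<longleftrightarrow>
    isolated_pos_roots F = {} \<or> finite (log_roots F) \<and> card (log_roots F) \<le> N"

lemma few_roots_isolated:
  assumes "few_roots N F"
  shows "finite (isolated_pos_roots F) \<and> card (isolated_pos_roots F) \<le> N"
proof (cases "isolated_pos_roots F = {}")
  case False
  have "isolated_pos_roots F \<subseteq> exp_vec ` log_roots F"
    unfolding pos_roots_eq_exp_vec[symmetric] isolated_pos_roots_def by blast
  with assms False show ?thesis unfolding few_roots_def
    by (meson card_image_le card_mono finite_imageI finite_subset le_trans)
qed simp

lemma few_roots_swap:
  assumes "few_roots N (f2, f1)" shows "few_roots N (f1, f2)"
proof -
  have p: "log_roots (f2, f1) = log_roots (f1, f2)" unfolding log_roots_def by auto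
  hence "pos_roots (f2, f1) = pos_roots (f1, f2)" unfolding pos_roots_eq_exp_vec by simp
  with p assms show ?thesis unfolding few_roots_def isolated_pos_roots_def by simp
qed

section \<open>Planar linear algebra and collinear supports\<close>

definition det2 :: "real^2 \<Rightarrow> real^2 \<Rightarrow> real"
  where "det2 x y = x $ 1 * y $ 2 - x $ 2 * y $ 1"

text \<open>
  With \<open>v1\<close> and \<open>v2\<close> two edge vectors of a support, the first expansion lets
  \<open>v1 \<bullet> u\<close> and \<open>v2 \<bullet> u\<close> serve as new unknowns, and the second one expresses every exponent
  vector through the two edges.
\<close>
lemma dual_basis:
  assumes "det2 v1 v2 \<noteq> 0"
  obtains w1 w2 where "v1 \<bullet> w1 = 1" "v1 \<bullet> w2 = 0" "v2 \<bullet> w1 = 0" "v2 \<bullet> w2 = 1"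
    "\<And>u. u = (v1 \<bullet> u) *\<^sub>R w1 + (v2 \<bullet> u) *\<^sub>R w2"
    "\<And>x. x = (x \<bullet> w1) *\<^sub>R v1 + (x \<bullet> w2) *\<^sub>R v2"
proof -
  define D where "D = det2 v1 v2"
  define w1 w2 :: "real^2" where "w1 = vector [v2 $ 2 / D, - v2 $ 1 / D]" and "w2 = vector [- v1 $ 2 / D, v1 $ 1 / D]"
  have D: "D \<noteq> 0" using assms unfolding D_def by simp
  have D': "v1 $ 1 * v2 $ 2 = D + v1 $ 2 * v2 $ 1" unfolding D_def det2_def by simp
  show ?thesis
  proof (rule that[of w1 w2])
    show "v1 \<bullet> w1 = 1" "v1 \<bullet> w2 = 0" "v2 \<bullet> w1 = 0" "v2 \<bullet> w2 = 1"
      unfolding w1_def w2_def using D D'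
      by (simp_all add: inner_vec_def sum_2 field_simps)
    show "u = (v1 \<bullet> u) *\<^sub>R w1 + (v2 \<bullet> u) *\<^sub>R w2" for u
    proof -
      have "D * u $ 1 = (v1 \<bullet> u) * v2 $ 2 - (v2 \<bullet> u) * v1 $ 2" "D * u $ 2 = (v2 \<bullet> u) * v1 $ 1 - (v1 \<bullet> u) * v2 $ 1"
        unfolding D_def det2_def by (simp_all add: inner_vec_def sum_2 algebra_simps)
      thus ?thesis unfolding w1_def w2_def using D
        by (simp add: vec_eq_iff forall_2 field_simps)
    qed
    show "x = (x \<bullet> w1) *\<^sub>R v1 + (x \<bullet> w2) *\<^sub>R v2" for x
    proof -
      have e: "x \<bullet> w1 = (x $ 1 * v2 $ 2 - x $ 2 * v2 $ 1) / D" "x \<bullet> w2 = (x $ 2 * v1 $ 1 - x $ 1 * v1 $ 2) / D"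
        unfolding w1_def w2_def by (simp_all add: inner_vec_def sum_2 diff_divide_distrib)
      moreover have "D * x $ 1 = (x $ 1 * v2 $ 2 - x $ 2 * v2 $ 1) * v1 $ 1 + (x $ 2 * v1 $ 1 - x $ 1 * v1 $ 2) * v2 $ 1"
         "D * x $ 2 = (x $ 1 * v2 $ 2 - x $ 2 * v2 $ 1) * v1 $ 2 + (x $ 2 * v1 $ 1 - x $ 1 * v1 $ 2) * v2 $ 2"
        unfolding D_def det2_def by (simp_all add: algebra_simps)
      ultimately have "x $ 1 = ((x $ 1 * v2 $ 2 - x $ 2 * v2 $ 1) * v1 $ 1 + (x $ 2 * v1 $ 1 - x $ 1 * v1 $ 2) * v2 $ 1) / D"
         "x $ 2 = ((x $ 1 * v2 $ 2 - x $ 2 * v2 $ 1) * v1 $ 2 + (x $ 2 * v1 $ 1 - x $ 1 * v1 $ 2) * v2 $ 2) / D"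
        using D by (metis nonzero_mult_div_cancel_left)+
      thus ?thesis unfolding e by (simp add: vec_eq_iff forall_2 add_divide_distrib)
    qed
  qed
qed

text \<open>
  Here \<open>s\<close> and \<open>r\<close> are coordinates adapted to a support lying on a line of direction \<open>v\<close>: all
  exponents \<open>a\<close> in it have the same value of \<open>a \<bullet> w2\<close>, so up to a nonzero factor the
  exponential sum depends on \<open>s\<close> only.
\<close>
lemma line_basis:
  assumes "v \<noteq> 0"
  obtains w1 w2 where "\<And>u. \<exists>s r. u = s *\<^sub>R w1 + r *\<^sub>R w2" "w2 \<noteq> 0"
    "\<And>x. det2 v x = 0 \<longleftrightarrow> x \<bullet> w2 = 0"
    "\<And>x. x \<bullet> w1 = 0 \<Longrightarrow> x \<bullet> w2 = 0 \<Longrightarrow> x = 0"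
proof -
  define n :: "real^2" where "n = vector [- v $ 2, v $ 1]"
  have "det2 v n = (v $ 1)\<^sup>2 + (v $ 2)\<^sup>2" unfolding n_def det2_def by (simp add: power2_eq_square)
  moreover have "v $ 1 \<noteq> 0 \<or> v $ 2 \<noteq> 0" using assms by (auto simp: vec_eq_iff forall_2)
  ultimately have d: "det2 v n \<noteq> 0" by (simp add: sum_power2_eq_zero_iff)
  then obtain w1 w2 where w: "v \<bullet> w1 = 1" "v \<bullet> w2 = 0" "n \<bullet> w1 = 0" "n \<bullet> w2 = 1"
    "\<And>u. u = (v \<bullet> u) *\<^sub>R w1 + (n \<bullet> u) *\<^sub>R w2"
    "\<And>x. x = (x \<bullet> w1) *\<^sub>R v + (x \<bullet> w2) *\<^sub>R n" using dual_basis by blast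
  show ?thesis
  proof (rule that[of w1 w2])
    show "\<exists>s r. u = s *\<^sub>R w1 + r *\<^sub>R w2" for u using w(5) by blast
    show "w2 \<noteq> 0" using w(4) by auto
    show "x = 0" if "x \<bullet> w1 = 0" "x \<bullet> w2 = 0" for x using w(6)[of x] that by simp
    show "det2 v x = 0 \<longleftrightarrow> x \<bullet> w2 = 0" for x
    proof -
      have "det2 v x = det2 v ((x \<bullet> w1) *\<^sub>R v + (x \<bullet> w2) *\<^sub>R n)" using w(6)[of x] by simp
      also have "\<dots> = (x \<bullet> w2) * det2 v n" unfolding det2_def by (simp add: algebra_simps)
      finally show ?thesis using d by simp
    qed
  qed
qed

text \<open>
  Translation along the common normal direction \<open>w2\<close> multiplies both exponential sums by nonzero
  factors, so every root lies on a line of roots.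
\<close>
lemma no_isolated_root_parallel:
  assumes v: "v \<noteq> 0"
    and f1: "\<And>a a'. a \<in> supp (fst F) \<Longrightarrow> a' \<in> supp (fst F) \<Longrightarrow> det2 v (a - a') = 0"
    and f2: "\<And>a a'. a \<in> supp (snd F) \<Longrightarrow> a' \<in> supp (snd F) \<Longrightarrow> det2 v (a - a') = 0"
  shows "isolated_pos_roots F = {}"
proof -
  obtain w1 w2 where w: "w2 \<noteq> 0" "\<And>x. det2 v x = 0 \<longleftrightarrow> x \<bullet> w2 = 0"
    using line_basis[OF v] by metis
  have shift: "exp_eval f (u + r *\<^sub>R w2) = 0"
    if f: "\<And>a a'. a \<in> supp f \<Longrightarrow> a' \<in> supp f \<Longrightarrow> det2 v (a - a') = 0" and "exp_eval f u = 0" for f u r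
  proof (cases "supp f = {}")
    case False
    then obtain a0 where a0: "a0 \<in> supp f" by blast
    have "a \<bullet> w2 = a0 \<bullet> w2" if "a \<in> supp f" for a
      using w(2)[of "a - a0"] f[OF that a0] by (simp add: inner_diff_left)
    hence "exp_eval f (u + r *\<^sub>R w2) = exp (r * (a0 \<bullet> w2)) * exp_eval f u"
      unfolding exp_eval_def sum_distrib_left
      by (intro sum.cong) (auto simp: inner_add_right exp_add algebra_simps)
    thus ?thesis using that(2) by simp
  qed (simp add: exp_eval_def)
  have "z \<notin> isolated_pos_roots F" for z
  proof
    assume z: "z \<in> isolated_pos_roots F"
    hence "z \<in> pos_roots F" unfolding isolated_pos_roots_def by blast
    then obtain u where u: "z = exp_vec u" "u \<in> log_roots F" unfolding pos_roots_eq_exp_vec by blast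
    have "exp_vec (u + 0 *\<^sub>R w2) \<notin> isolated_pos_roots F"
    proof (rule not_isolated_if_on_curve[of 1 "\<lambda>r. u + r *\<^sub>R w2"])
      show "inj_on (\<lambda>r. u + r *\<^sub>R w2) {- 1..1}" using w(1) by (auto simp: inj_on_def)
      show "u + r *\<^sub>R w2 \<in> log_roots F" for r
        using shift[of "fst F" u r, OF f1] shift[of "snd F" u r, OF f2] u(2) unfolding log_roots_def by auto
    qed (auto intro!: continuous_intros)
    thus False using z u(1) by simp
  qed
  thus ?thesis by blast
qed

text \<open>
  The first equation confines \<open>s\<close> to two values. For each of them the second one is an
  exponential sum in \<open>r\<close> with at most three distinct exponents, so it has at most two zeros
  unless it vanishes identically. That is impossible: among the values \<open>b \<bullet> w2\<close> of the three
  exponents of \<open>f2\<close>, which are not all equal, one is attained only once.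
\<close>
lemma few_roots_one_collinear:
  assumes v: "v \<noteq> 0" and F: "has_type (3, 3) (f1, f2)"
    and f1: "\<And>a a'. a \<in> supp f1 \<Longrightarrow> a' \<in> supp f1 \<Longrightarrow> det2 v (a - a') = 0"
    and f2: "b \<in> supp f2" "b' \<in> supp f2" "det2 v (b - b') \<noteq> 0"
  shows "few_roots 4 (f1, f2)"
proof -
  obtain w1 w2 where w: "\<And>u. \<exists>s r. u = s *\<^sub>R w1 + r *\<^sub>R w2" "\<And>x. det2 v x = 0 \<longleftrightarrow> x \<bullet> w2 = 0"
    "\<And>x. x \<bullet> w1 = 0 \<Longrightarrow> x \<bullet> w2 = 0 \<Longrightarrow> x = 0"
    using line_basis[OF v] by metis
  have card3: "card (supp f1) = 3" "card (supp f2) = 3" using F by (auto simp: has_type_def nomial_def)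
  obtain a0 where a0: "a0 \<in> supp f1" using card3 by fastforce
  define S where "S = {s. (\<Sum>a\<in>supp f1. cf f1 a * exp ((a \<bullet> w1) * s)) = 0}"
  define R where "R s = {r. (\<Sum>b\<in>supp f2. (cf f2 b * exp ((b \<bullet> w1) * s)) * exp ((b \<bullet> w2) * r)) = 0}" for s
  have aw: "a \<bullet> w2 = a0 \<bullet> w2" if "a \<in> supp f1" for a
    using w(2)[of "a - a0"] f1[OF that a0] by (simp add: inner_diff_left)
  have E1: "exp_eval f1 (s *\<^sub>R w1 + r *\<^sub>R w2) = exp (r * (a0 \<bullet> w2)) * (\<Sum>a\<in>supp f1. cf f1 a * exp ((a \<bullet> w1) * s))" for s r
    unfolding exp_eval_def sum_distrib_left
    by (intro sum.cong) (auto simp: inner_add_right exp_add algebra_simps aw)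
  have E2: "exp_eval f2 (s *\<^sub>R w1 + r *\<^sub>R w2) = (\<Sum>b\<in>supp f2. (cf f2 b * exp ((b \<bullet> w1) * s)) * exp ((b \<bullet> w2) * r))" for s r
    unfolding exp_eval_def
    by (intro sum.cong) (auto simp: inner_add_right exp_add algebra_simps)
  have S: "finite S \<and> card S < card (supp f1)"
    unfolding S_def
  proof (rule exp_sum_root_count_indexed[OF finite_keys a0])
    show "cf f1 a0 \<noteq> 0" using a0 by (simp add: in_keys_iff)
    show "a = a0" if "a \<in> supp f1" "a \<bullet> w1 = a0 \<bullet> w1" for a
      using w(3)[of "a - a0"] aw[OF that(1)] that(2) by (simp add: inner_diff_left)
  qed
  have ne: "b \<bullet> w2 \<noteq> b' \<bullet> w2" using f2(3) w(2)[of "b - b'"] by (simp add: inner_diff_left)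
  have "card (supp f2 - {b, b'}) = 1" using ne f2 card3(2) by (cases "b = b'") (auto simp: card_Diff_subset)
  then obtain b'' where b'': "supp f2 - {b, b'} = {b''}" by (auto simp: card_1_singleton_iff)
  with f2 have supp: "supp f2 = {b, b', b''}" by blast
  have "\<exists>c\<in>supp f2. \<forall>d\<in>supp f2. d \<bullet> w2 = c \<bullet> w2 \<longrightarrow> d = c"
    unfolding supp using ne by (metis empty_iff insert_iff)
  then obtain c where c: "c \<in> supp f2" "\<And>d. d \<in> supp f2 \<Longrightarrow> d \<bullet> w2 = c \<bullet> w2 \<Longrightarrow> d = c" by blast
  have R: "finite (R s) \<and> card (R s) < card (supp f2)" for s
    unfolding R_def
    by (rule exp_sum_root_count_indexed[OF finite_keys c(1)]) (use c in \<open>auto simp: in_keys_iff\<close>)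
  have sub: "log_roots (f1, f2) \<subseteq> (\<Union>s\<in>S. (\<lambda>r. s *\<^sub>R w1 + r *\<^sub>R w2) ` R s)" (is "_ \<subseteq> ?U")
  proof
    fix u assume u: "u \<in> log_roots (f1, f2)"
    obtain s r where sr: "u = s *\<^sub>R w1 + r *\<^sub>R w2" using w(1) by blast
    with u have "s \<in> S" "r \<in> R s" unfolding log_roots_def S_def R_def by (auto simp: E1 E2)
    thus "u \<in> ?U" using sr by blast
  qed
  have R2: "card (R s) \<le> 2" for s using R[of s] card3 by simp
  have "card ?U \<le> (\<Sum>s\<in>S. card ((\<lambda>r. s *\<^sub>R w1 + r *\<^sub>R w2) ` R s))"
    using S by (intro card_UN_le) simp
  also have "\<dots> \<le> (\<Sum>s\<in>S. 2)"
    using R R2 by (intro sum_mono order_trans[OF card_image_le]) simp_all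
  also have "\<dots> \<le> 4"
    using S card3 by simp
  finally have c: "card ?U \<le> 4" .
  have f: "finite ?U"
    using S R by simp
  show ?thesis
    unfolding few_roots_def using finite_subset[OF sub f] card_mono[OF f sub] c by simp
qed

section \<open>Two triangles with a common edge direction\<close>

text \<open>
  In the unknowns \<open>X = exp ((a1 - a0) \<bullet> u)\<close> and \<open>Y = exp ((a2 - a0) \<bullet> u)\<close> the system reads
  \<open>c0 + c1 X + c2 Y = 0\<close>, \<open>d0 + d1 X\<^sup>\<mu> + d2 X\<^sup>p Y\<^sup>q = 0\<close>: the parallel edges make the second monomial a
  pure power of \<open>X\<close>. Substituting \<open>Y = \<alpha> + \<beta> X\<close> identifies the roots with the zeros of the
  function \<open>g\<close> bounded by \<open>eliminated_root_count\<close>. For homothetic triangles \<open>p = 0\<close> and \<open>q = \<mu>\<close>,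
  and the quadratic polynomial degenerates to a linear monomial in \<open>t\<close>. Its lack of positive zeros
  lowers the bound by two.
\<close>
lemma few_roots_parallel_edge:
  assumes F: "has_type (3, 3) (f1, f2)"
    and supp: "supp f1 = {a0, a1, a2}" "supp f2 = {b0, b1, b2}"
    and A: "det2 (a1 - a0) (a2 - a0) \<noteq> 0" and B: "det2 (b1 - b0) (b2 - b0) \<noteq> 0"
    and par: "b1 - b0 = \<mu> *\<^sub>R (a1 - a0)"
  shows "few_roots 4 (f1, f2)" and "b2 - b0 = \<mu> *\<^sub>R (a2 - a0) \<Longrightarrow> few_roots 2 (f1, f2)"
proof -
  obtain w1 w2 where w: "(a1 - a0) \<bullet> w1 = 1" "(a1 - a0) \<bullet> w2 = 0" "(a2 - a0) \<bullet> w1 = 0" "(a2 - a0) \<bullet> w2 = 1"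
    and coord: "\<And>u. u = ((a1 - a0) \<bullet> u) *\<^sub>R w1 + ((a2 - a0) \<bullet> u) *\<^sub>R w2"
    and comb: "\<And>x. x = (x \<bullet> w1) *\<^sub>R (a1 - a0) + (x \<bullet> w2) *\<^sub>R (a2 - a0)"
    using dual_basis[OF A] by blast
  define p where "p = (b2 - b0) \<bullet> w1"
  define q where "q = (b2 - b0) \<bullet> w2"
  have b2: "b2 - b0 = p *\<^sub>R (a1 - a0) + q *\<^sub>R (a2 - a0)" unfolding p_def q_def by (rule comb)
  have card3: "card {a0, a1, a2} = 3" "card {b0, b1, b2} = 3"
    using F supp by (auto simp: has_type_def nomial_def)
  have dist: "a0 \<noteq> a1" "a0 \<noteq> a2" "a1 \<noteq> a2" "b0 \<noteq> b1" "b0 \<noteq> b2" "b1 \<noteq> b2"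
    using card3 by (auto simp: card_insert_if split: if_splits)
  define c0 c1 c2 d0 d1 d2 where c: "c0 = cf f1 a0" "c1 = cf f1 a1" "c2 = cf f1 a2"
    and d: "d0 = cf f2 b0" "d1 = cf f2 b1" "d2 = cf f2 b2"
  have nz: "c0 \<noteq> 0" "c1 \<noteq> 0" "c2 \<noteq> 0" "d2 \<noteq> 0"
    unfolding c d using supp by (simp_all flip: Poly_Mapping.in_keys_iff)
  have mu: "\<mu> \<noteq> 0" using B par by (auto simp: det2_def)
  define \<alpha> \<beta> where "\<alpha> = - c0 / c2" and "\<beta> = - c1 / c2"
  have ab: "\<alpha> \<noteq> 0" "\<beta> \<noteq> 0" unfolding \<alpha>_def \<beta>_def using nz by auto
  have E1: "exp_eval f1 u = exp (a0 \<bullet> u) * (c0 + c1 * exp ((a1 - a0) \<bullet> u) + c2 * exp ((a2 - a0) \<bullet> u))" for u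
    unfolding exp_eval_def supp using dist(1-3)
    by (simp add: c algebra_simps exp_diff inner_diff_left)
  have E2: "exp_eval f2 u = exp (b0 \<bullet> u) * (d0 + d1 * exp (\<mu> * ((a1 - a0) \<bullet> u))
              + d2 * exp (p * ((a1 - a0) \<bullet> u) + q * ((a2 - a0) \<bullet> u)))" for u
  proof -
    have "exp_eval f2 u = exp (b0 \<bullet> u) * (d0 + d1 * exp ((b1 - b0) \<bullet> u) + d2 * exp ((b2 - b0) \<bullet> u))"
      unfolding exp_eval_def supp using dist(4-6)
      by (simp add: d algebra_simps exp_diff inner_diff_left)
    thus ?thesis unfolding par b2 by (simp add: inner_add_left)
  qed
  define I where "I = {t. 0 < t \<and> 0 < \<alpha> + \<beta> * t}"
  define g where "g t = d0 + d1 * t powr \<mu> + d2 * (t powr p * (\<alpha> + \<beta> * t) powr q)" for t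
  define \<psi> where "\<psi> t = ln t *\<^sub>R w1 + ln (\<alpha> + \<beta> * t) *\<^sub>R w2" for t
  have psi: "(a1 - a0) \<bullet> \<psi> t = ln t" "(a2 - a0) \<bullet> \<psi> t = ln (\<alpha> + \<beta> * t)" for t
    unfolding \<psi>_def by (simp_all add: inner_add_right w)
  have roots: "log_roots (f1, f2) = \<psi> ` {t \<in> I. g t = 0}"
  proof (intro equalityI subsetI)
    fix u assume u: "u \<in> log_roots (f1, f2)"
    define t where "t = exp ((a1 - a0) \<bullet> u)"
    have t: "exp ((a2 - a0) \<bullet> u) = \<alpha> + \<beta> * t"
    proof -
      have "c0 + c1 * t + c2 * exp ((a2 - a0) \<bullet> u) = 0"
        using u unfolding log_roots_def t_def by (simp add: E1)
      thus ?thesis using nz unfolding \<alpha>_def \<beta>_def by (simp add: field_simps)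
    qed
    have pos: "t > 0" "\<alpha> + \<beta> * t > 0" unfolding t[symmetric] by (simp_all add: t_def)
    have ln: "ln t = (a1 - a0) \<bullet> u" "ln (\<alpha> + \<beta> * t) = (a2 - a0) \<bullet> u"
      unfolding t[symmetric] by (simp_all add: t_def)
    have "g t = 0"
      using u pos unfolding log_roots_def g_def by (auto simp: E2 powr_def ln exp_add)
    moreover have "u = \<psi> t" unfolding \<psi>_def ln by (rule coord)
    ultimately show "u \<in> \<psi> ` {t \<in> I. g t = 0}" unfolding I_def using pos by blast
  next
    fix u assume "u \<in> \<psi> ` {t \<in> I. g t = 0}"
    then obtain t where t: "u = \<psi> t" "t > 0" "\<alpha> + \<beta> * t > 0" "g t = 0" unfolding I_def by auto
    have "exp_eval f1 u = 0"
      unfolding E1 t(1) psi using t(2,3) nz by (simp add: \<alpha>_def \<beta>_def field_simps)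
    moreover have "exp_eval f2 u = 0"
      using t(4) unfolding E2 t(1) psi g_def using t(2,3) by (simp add: powr_def exp_add)
    ultimately show "u \<in> log_roots (f1, f2)" unfolding log_roots_def by simp
  qed
  have inj: "inj_on \<psi> I"
  proof (rule inj_onI)
    fix s t assume st: "s \<in> I" "t \<in> I" "\<psi> s = \<psi> t"
    hence "ln s = ln t" using psi(1) by metis
    thus "s = t" using st(1,2) unfolding I_def by simp
  qed
  have cont: "continuous_on I \<psi>"
    unfolding \<psi>_def I_def by (auto intro!: continuous_intros)
  have "open I"
    unfolding I_def by (intro open_Collect_conj open_Collect_less continuous_intros)
  have few: "few_roots (k + 2) (f1, f2)"
    if g: "(\<forall>t\<in>I. g t = 0) \<or> finite {t \<in> I. g t = 0} \<and> card {t \<in> I. g t = 0} \<le> k + 2" for k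
    using g
  proof
    assume 0: "\<forall>t\<in>I. g t = 0"
    have "z \<notin> isolated_pos_roots (f1, f2)" for z
    proof
      assume z: "z \<in> isolated_pos_roots (f1, f2)"
      then obtain t where t: "t \<in> I" "z = exp_vec (\<psi> t)"
        unfolding isolated_pos_roots_def pos_roots_eq_exp_vec roots by auto
      obtain \<delta> where \<delta>: "\<delta> > 0" "cball t \<delta> \<subseteq> I" using \<open>open I\<close> t(1) open_contains_cball by metis
      have I: "t + x \<in> I" if "x \<in> {-\<delta>..\<delta>}" for x
        using \<delta>(2) that by (auto simp: dist_real_def)
      have "exp_vec (\<psi> (t + 0)) \<notin> isolated_pos_roots (f1, f2)"
      proof (rule not_isolated_if_on_curve[OF \<delta>(1)])
        have "(\<lambda>x. t + x) ` {-\<delta>..\<delta>} \<subseteq> I" by (rule image_subsetI) (rule I)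
        thus "continuous_on {-\<delta>..\<delta>} (\<lambda>x. \<psi> (t + x))"
          by (rule continuous_on_compose2[OF cont, rotated]) (intro continuous_intros)
        show "inj_on (\<lambda>x. \<psi> (t + x)) {-\<delta>..\<delta>}"
        proof (rule inj_onI)
          fix x y assume "x \<in> {-\<delta>..\<delta>}" "y \<in> {-\<delta>..\<delta>}" "\<psi> (t + x) = \<psi> (t + y)"
          with inj_onD[OF inj, of "t + x" "t + y"] I[of x] I[of y] show "x = y" by simp
        qed
        show "\<psi> (t + x) \<in> log_roots (f1, f2)" if "x \<in> {-\<delta>..\<delta>}" for x
          unfolding roots using I[OF that] 0 by blast
      qed
      thus False using z t(2) by simp
    qed
    thus ?thesis unfolding few_roots_def by blast
  next
    assume "finite {t \<in> I. g t = 0} \<and> card {t \<in> I. g t = 0} \<le> k + 2"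
    thus ?thesis unfolding few_roots_def roots
      using card_image_le[of "{t \<in> I. g t = 0}" \<psi>] by (meson finite_imageI le_trans)
  qed
  define Q where "Q t = (p - \<mu>) * (\<alpha> + \<beta> * t) * (p * \<alpha> + (p + q) * \<beta> * t)
               + (q - 1) * \<beta> * t * (p * \<alpha> + (p + q) * \<beta> * t) + (p + q) * \<beta> * t * (\<alpha> + \<beta> * t)" for t
  have main: "few_roots (k + 2) (f1, f2)"
    if "(\<forall>t. Q t = 0) \<or> finite {t \<in> I. Q t = 0} \<and> card {t \<in> I. Q t = 0} \<le> k" for k
    using few[of k] eliminated_root_count[OF nz(4), of p \<mu> \<alpha> \<beta> q k d0 d1] that
    unfolding Q_def I_def g_def by blast
  have Qpoly: "Q t = (\<beta>\<^sup>2 * (p + q) * (p + q - \<mu>)) * t\<^sup>2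
      + (\<alpha> * \<beta> * ((p - \<mu>) * (2 * p + q) + (q - 1) * p + p + q)) * t + (p - \<mu>) * p * \<alpha>\<^sup>2" for t
    unfolding Q_def by (simp add: algebra_simps power2_eq_square)
  have "(\<forall>t. Q t = 0) \<or> finite {t \<in> I. Q t = 0} \<and> card {t \<in> I. Q t = 0} \<le> 2"
  proof -
    obtain a b c where Q: "\<And>t. Q t = a * t\<^sup>2 + b * t + c" using Qpoly by blast
    show ?thesis
      unfolding Q by (cases "a = 0 \<and> b = 0 \<and> c = 0") (simp, rule disjI2, rule quadratic_root_count)
  qed
  from main[OF this] show "few_roots 4 (f1, f2)" by simp
  show "few_roots 2 (f1, f2)" if "b2 - b0 = \<mu> *\<^sub>R (a2 - a0)"
  proof -
    have pq: "p = 0" "q = \<mu>" unfolding p_def q_def that by (simp_all add: w)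
    have Q: "Q t = \<mu> * (1 - \<mu>) * \<alpha> * \<beta> * t" for t
      unfolding Q_def pq by (simp add: algebra_simps)
    have "(\<forall>t. Q t = 0) \<or> {t \<in> I. Q t = 0} = {}"
      unfolding Q I_def using ab mu by auto
    hence "(\<forall>t. Q t = 0) \<or> finite {t \<in> I. Q t = 0} \<and> card {t \<in> I. Q t = 0} \<le> 0"
      by (rule disj_forward) (assumption, simp only: card.empty finite.emptyI le0 simp_thms)
    from main[OF this] show ?thesis by (simp add: numeral_2_eq_2)
  qed
qed

section \<open>Vertices of a Minkowski sum of two triangles\<close>

definition on_line :: "real^2 \<Rightarrow> (real^2) set \<Rightarrow> bool"
  where "on_line v S \<longleftrightarrow> (\<forall>x\<in>S. \<forall>y\<in>S. det2 v (x - y) = 0)"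

lemma det2_self: "det2 x x = 0" by (simp add: det2_def)

lemma det2_zero_imp_scaled:
  assumes "v \<noteq> 0" "det2 v x = 0"
  obtains c where "x = c *\<^sub>R v"
proof -
  have "v $ 1 \<noteq> 0 \<or> v $ 2 \<noteq> 0" using assms(1) by (auto simp: vec_eq_iff forall_2)
  thus ?thesis
  proof
    assume "v $ 1 \<noteq> 0"
    thus ?thesis using assms(2)
      by (intro that[of "x $ 1 / v $ 1"]) (auto simp: vec_eq_iff forall_2 det2_def field_simps)
  next
    assume "v $ 2 \<noteq> 0"
    thus ?thesis using assms(2)
      by (intro that[of "x $ 2 / v $ 2"]) (auto simp: vec_eq_iff forall_2 det2_def field_simps)
  qed
qed

lemma aff_dim_on_line:
  assumes "v \<noteq> 0" "on_line v S" shows "aff_dim S \<le> 1"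
proof -
  have "\<exists>c. x - y = c *\<^sub>R v" if "x \<in> S" "y \<in> S" for x y
    using det2_zero_imp_scaled[OF assms(1)] assms(2) that unfolding on_line_def by metis
  hence "collinear S" unfolding collinear_def by blast
  thus ?thesis by (simp add: collinear_aff_dim)
qed

lemma on_line_plus:
  assumes "on_line v A" "on_line v B" shows "on_line v (A + B)"
proof -
  have "det2 v ((a + b) - (a' + b')) = det2 v (a - a') + det2 v (b - b')" for a a' b b'
    by (simp add: det2_def algebra_simps)
  with assms show ?thesis unfolding on_line_def by (auto elim!: set_plus_elim)
qed

lemma spread_triple:
  assumes "card A = 3" "\<not> (\<exists>v. v \<noteq> 0 \<and> on_line v A)" "a \<in> A" "a' \<in> A" "a \<noteq> a'"
  obtains a'' where "A = {a, a', a''}" "a'' \<noteq> a" "a'' \<noteq> a'" "det2 (a' - a) (a'' - a) \<noteq> 0"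
proof -
  have "finite A" using assms(1) card.infinite by fastforce
  hence "card (A - {a, a'}) = 1" using assms by (simp add: card_Diff_subset)
  then obtain a'' where a'': "A - {a, a'} = {a''}" by (auto simp: card_1_singleton_iff)
  hence A: "A = {a, a', a''}" using assms by blast
  have "a' - a \<noteq> 0" using assms(5) by simp
  hence "\<not> on_line (a' - a) A" using assms(2) by blast
  hence "det2 (a' - a) (a'' - a) \<noteq> 0"
    unfolding on_line_def A by (auto simp: det2_def algebra_simps)
  thus ?thesis using that A a'' by blast
qed

lemma exposed_extreme_point:
  fixes v w :: "'a::euclidean_space"
  assumes "finite S" "v \<in> S" "\<And>x. x \<in> S - {v} \<Longrightarrow> w \<bullet> x < w \<bullet> v"
  shows "v extreme_point_of (convex hull S)"
proof -
  have "convex hull (S - {v}) \<subseteq> {x. w \<bullet> x < w \<bullet> v}"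
    by (rule hull_minimal) (use assms(3) convex_halfspace_lt in auto)
  hence "v extreme_point_of (convex hull (insert v (S - {v})))"
    using assms(1) by (intro extreme_point_of_convex_hull_insert) auto
  thus ?thesis using assms(2) by (simp add: insert_absorb)
qed

lemma newton_sum_eq_hull: "newton_sum F = convex hull (supp (fst F) + supp (snd F))"
  unfolding newton_sum_def Newt_def by (simp add: convex_hull_set_plus)

text \<open>
  Measure points by their height over the edge \<open>p0 p1\<close>, which is nonnegative on the triangle.
  The heights of the exchanged sums \<open>a0 + b1\<close> and \<open>a1 + b0\<close> add up to the heights of \<open>p0\<close> and
  \<open>p1\<close>, hence to zero, so both lie on the edge.
\<close>
lemma triangle_edge_parallel:
  assumes D: "det2 (p1 - p0) (p2 - p0) \<noteq> 0"
    and p: "p0 = a0 + b0" "p1 = a1 + b1"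
    and P: "a0 + b1 \<in> convex hull {p0, p1, p2}" "a1 + b0 \<in> convex hull {p0, p1, p2}"
  shows "det2 (p1 - p0) (b1 - b0) = 0"
proof -
  obtain u v where uv: "a0 + b1 = p0 + u *\<^sub>R (p1 - p0) + v *\<^sub>R (p2 - p0)" "v \<ge> 0"
    using P(1) unfolding convex_hull_3_alt by auto
  obtain u' v' where uv': "a1 + b0 = p0 + u' *\<^sub>R (p1 - p0) + v' *\<^sub>R (p2 - p0)" "v' \<ge> 0"
    using P(2) unfolding convex_hull_3_alt by auto
  have lin: "det2 x ((s *\<^sub>R x + t *\<^sub>R y) + (s' *\<^sub>R x + t' *\<^sub>R y)) = (t + t') * det2 x y" for x y s t s' t'
    by (simp_all add: det2_def algebra_simps)
  have e: "b1 - b0 = u *\<^sub>R (p1 - p0) + v *\<^sub>R (p2 - p0)" using uv(1) p(1) by (simp add: algebra_simps)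
  have e': "a1 - a0 = u' *\<^sub>R (p1 - p0) + v' *\<^sub>R (p2 - p0)" using uv'(1) p(1) by (simp add: algebra_simps)
  have "det2 (p1 - p0) ((b1 - b0) + (a1 - a0)) = (v + v') * det2 (p1 - p0) (p2 - p0)"
    unfolding e e' by (rule lin)
  moreover have "(b1 - b0) + (a1 - a0) = p1 - p0" using p by simp
  ultimately have "v + v' = 0" using D by (simp add: det2_self)
  hence "v = 0" using uv(2) uv'(2) by simp
  thus ?thesis unfolding e by (simp add: det2_def algebra_simps)
qed

text \<open>
  If the translate of an edge of the triangle by \<open>a - c\<close> stays in the triangle, then \<open>a = c\<close>:
  no segment in a triangle other than an edge itself is a translate of that edge.
\<close>
lemma summand_point_unique:
  assumes D: "det2 (p1 - p0) (p2 - p0) \<noteq> 0"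
    and p: "p0 = c + b0" "p1 = c + b1"
    and P: "a + b0 \<in> convex hull {p0, p1, p2}" "a + b1 \<in> convex hull {p0, p1, p2}"
  shows "a = c"
proof -
  obtain u v where uv: "a + b0 = p0 + u *\<^sub>R (p1 - p0) + v *\<^sub>R (p2 - p0)" "u \<ge> 0" "v \<ge> 0"
    using P(1) unfolding convex_hull_3_alt by auto
  obtain u' v' where uv': "a + b1 = p0 + u' *\<^sub>R (p1 - p0) + v' *\<^sub>R (p2 - p0)" "v' \<ge> 0" "u' + v' \<le> 1"
    using P(2) unfolding convex_hull_3_alt by auto
  have e: "a - c = u *\<^sub>R (p1 - p0) + v *\<^sub>R (p2 - p0)" using uv(1) p(1) by (simp add: algebra_simps)
  have e': "a - c = (u' - 1) *\<^sub>R (p1 - p0) + v' *\<^sub>R (p2 - p0)" using uv'(1) p by (simp add: algebra_simps)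
  have "det2 (s *\<^sub>R x + t *\<^sub>R y) y = s * det2 x y" for x y s t by (simp add: det2_def algebra_simps)
  hence "u * det2 (p1 - p0) (p2 - p0) = (u' - 1) * det2 (p1 - p0) (p2 - p0)"
    using e e' by metis
  hence "u = u' - 1" using D by simp
  hence "u = 0" "v' = 0" "u' = 1" using uv uv' by auto
  thus ?thesis using e' by simp
qed

text \<open>
  Write the vertices of the triangle as \<open>p\<^sub>i = a\<^sub>i + b\<^sub>i\<close>. By \<open>triangle_edge_parallel\<close> each difference
  \<open>b\<^sub>i - b\<^sub>j\<close> is a multiple of \<open>p\<^sub>i - p\<^sub>j\<close>; since the three differences add up to zero around the
  triangle, the three factors are one number \<open>m\<close>, and \<open>1 - m\<close> is the factor for the \<open>a\<^sub>i\<close>.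
  Neither summand is a single point, which excludes \<open>m = 0\<close> and \<open>m = 1\<close>, so that the \<open>a\<^sub>i\<close> and the
  \<open>b\<^sub>i\<close> exhaust \<open>A\<close> and \<open>B\<close>.
\<close>
lemma triangle_sum_homothetic:
  assumes A: "card A = 3" and B: "card B = 3" and P: "polygon 3 (convex hull (A + B))"
  obtains a0 a1 a2 b0 b1 b2 \<mu> where "A = {a0, a1, a2}" "B = {b0, b1, b2}"
    "det2 (a1 - a0) (a2 - a0) \<noteq> 0" "det2 (b1 - b0) (b2 - b0) \<noteq> 0"
    "b1 - b0 = \<mu> *\<^sub>R (a1 - a0)" "b2 - b0 = \<mu> *\<^sub>R (a2 - a0)"
proof -
  let ?P = "convex hull (A + B)"
  have fin: "finite A" "finite B" using A B card.infinite by fastforce+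
  obtain p0 p1 p2 where ext: "{v. v extreme_point_of ?P} = {p0, p1, p2}" 
    using P unfolding polygon_def card_3_iff by auto
  have hull: "?P = convex hull {p0, p1, p2}"
    using Krein_Milman_polytope[of "A + B"] fin ext by (simp add: finite_set_plus)
  have inP: "a + b \<in> convex hull {p0, p1, p2}" if "a \<in> A" "b \<in> B" for a b
    unfolding hull[symmetric] using that by (intro hull_inc set_plus_intro)
  have D: "det2 (p1 - p0) (p2 - p0) \<noteq> 0"
  proof
    assume "det2 (p1 - p0) (p2 - p0) = 0"
    moreover have "p0 \<noteq> p1" using P ext unfolding polygon_def by (auto simp: card_insert_if split: if_splits)
    ultimately have "p1 - p0 \<noteq> 0" "on_line (p1 - p0) {p0, p1, p2}"
      unfolding on_line_def by (auto simp: det2_def algebra_simps)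
    from aff_dim_on_line[OF this] show False
      using P hull unfolding polygon_def by (simp add: aff_dim_convex_hull)
  qed
  have "p \<in> A + B" if "p \<in> {p0, p1, p2}" for p
    using that extreme_point_of_convex_hull unfolding ext[symmetric] by blast
  then obtain a0 a1 a2 b0 b1 b2 where ab: "a0 \<in> A" "b0 \<in> B" "a1 \<in> A" "b1 \<in> B" "a2 \<in> A" "b2 \<in> B"
    and p: "p0 = a0 + b0" "p1 = a1 + b1" "p2 = a2 + b2"
    by (metis insertI1 insertI2 set_plus_elim)
  define U V where "U = p1 - p0" and "V = p2 - p0"
  have UV: "det2 U V \<noteq> 0" using D unfolding U_def V_def .
  hence nz: "U \<noteq> 0" "V \<noteq> 0" by (auto simp: det2_def)
  have D': "det2 (p2 - p0) (p1 - p0) \<noteq> 0" "det2 (p2 - p1) (p0 - p1) \<noteq> 0"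
    using D by (auto simp: det2_def algebra_simps)
  have perm: "{p0, p2, p1} = {p0, p1, p2}" "{p1, p2, p0} = {p0, p1, p2}" by auto
  have e01: "det2 U (b1 - b0) = 0"
    unfolding U_def by (rule triangle_edge_parallel[OF D p(1,2)]) (use inP ab in auto)
  have e02: "det2 V (b2 - b0) = 0"
    unfolding V_def by (rule triangle_edge_parallel[OF D'(1) p(1,3)]) (use inP ab perm in auto)
  have e12: "det2 (p2 - p1) (b2 - b1) = 0"
    by (rule triangle_edge_parallel[OF D'(2) p(2,3)]) (use inP ab perm in auto)
  obtain m where m: "b1 - b0 = m *\<^sub>R U" using det2_zero_imp_scaled[OF nz(1) e01] .
  obtain n where n: "b2 - b0 = n *\<^sub>R V" using det2_zero_imp_scaled[OF nz(2) e02] .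
  have "0 = det2 (V - U) ((b2 - b0) - (b1 - b0))" using e12 unfolding U_def V_def by simp
  also have "\<dots> = (m - n) * det2 U V" unfolding m n by (simp add: det2_def algebra_simps)
  finally have mn: "m = n" using UV by simp
  have a1: "a1 - a0 = (1 - m) *\<^sub>R U"
  proof -
    have "a1 - a0 = U - (b1 - b0)" unfolding U_def p by simp
    thus ?thesis unfolding m by (simp add: scaleR_left_diff_distrib)
  qed
  have a2: "a2 - a0 = (1 - m) *\<^sub>R V"
  proof -
    have "a2 - a0 = V - (b2 - b0)" unfolding V_def p by simp
    thus ?thesis unfolding n mn by (simp add: scaleR_left_diff_distrib)
  qed
  \<comment> \<open>For \<open>m = 1\<close> the points \<open>a0\<close> and \<open>a1\<close> coincide, and every point of \<open>A\<close> equals them.\<close>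
  have m1: "m \<noteq> 1"
  proof
    assume "m = 1"
    hence "a1 = a0" using a1 by simp
    hence "a = a0" if "a \<in> A" for a
      using summand_point_unique[OF D p(1), of b1 a] p(2) inP[OF that] ab by simp
    hence "A \<subseteq> {a0}" by blast
    thus False using A card_mono[of "{a0}" A] by simp
  qed
  have m0: "m \<noteq> 0"
  proof
    assume "m = 0"
    hence eq: "b1 = b0" using m by simp
    have "b = b0" if "b \<in> B" for b
      using summand_point_unique[OF D, of b0 a0 a1 b] p(1,2) inP[OF _ that] ab eq by (simp add: add.commute)
    hence "B \<subseteq> {b0}" by blast
    thus False using B card_mono[of "{b0}" B] by simp
  qed
  have scale: "det2 (s *\<^sub>R U) (s *\<^sub>R V) = s * s * det2 U V" for s by (simp add: det2_def algebra_simps)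
  have dA: "det2 (a1 - a0) (a2 - a0) \<noteq> 0" unfolding a1 a2 scale using UV m1 by simp
  have dB: "det2 (b1 - b0) (b2 - b0) \<noteq> 0" unfolding m n mn[symmetric] scale using UV m0 by simp
  have triple: "S = {x0, x1, x2}" if "card S = 3" "finite S" "x0 \<in> S" "x1 \<in> S" "x2 \<in> S" "det2 (x1 - x0) (x2 - x0) \<noteq> 0" for S x0 x1 x2
  proof -
    have "x0 \<noteq> x1" "x0 \<noteq> x2" "x1 \<noteq> x2" using that(6) by (auto simp: det2_def)
    thus ?thesis using that by (intro card_subset_eq[symmetric]) auto
  qed
  show ?thesis
  proof (rule that[OF triple[OF A fin(1) ab(1,3,5) dA] triple[OF B fin(2) ab(2,4,6) dB] dA dB])
    show "b1 - b0 = (m / (1 - m)) *\<^sub>R (a1 - a0)" unfolding m a1 using m1 by simp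
    show "b2 - b0 = (m / (1 - m)) *\<^sub>R (a2 - a0)" unfolding n a2 using m1 mn by simp
  qed
qed

text \<open>
  The vector \<open>n a\<close> is the outward normal of the edge opposite to \<open>a\<close>, namely minus the gradient
  of the barycentric coordinate of \<open>a\<close>. Barycentric coordinates add up to one, so these normals
  add up to zero.
\<close>
lemma outward_normals:
  assumes "card A = 3" "\<not> (\<exists>v. v \<noteq> 0 \<and> on_line v A)"
  obtains n where "\<And>a x. a \<in> A \<Longrightarrow> x \<in> A - {a} \<Longrightarrow> n a \<bullet> a < n a \<bullet> x"
    "\<And>a x y. a \<in> A \<Longrightarrow> x \<in> A - {a} \<Longrightarrow> y \<in> A - {a} \<Longrightarrow> n a \<bullet> x = n a \<bullet> y"
    "(\<Sum>a\<in>A. n a) = 0"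
proof -
  obtain a0 a1 where "a0 \<in> A" "a1 \<in> A" "a0 \<noteq> a1" using assms(1) unfolding card_3_iff by auto
  then obtain a2 where A: "A = {a0, a1, a2}" "a0 \<noteq> a1" "a2 \<noteq> a0" "a2 \<noteq> a1" "det2 (a1 - a0) (a2 - a0) \<noteq> 0"
    using spread_triple[OF assms] by metis
  obtain w1 w2 where w: "(a1 - a0) \<bullet> w1 = 1" "(a1 - a0) \<bullet> w2 = 0" "(a2 - a0) \<bullet> w1 = 0" "(a2 - a0) \<bullet> w2 = 1"
    using dual_basis[OF A(5)] by metis
  define n where "n a = (if a = a0 then w1 + w2 else if a = a1 then - w1 else - w2)" for a
  have n: "n a0 = w1 + w2" "n a1 = - w1" "n a2 = - w2" unfolding n_def using A by auto
  have v: "a1 \<bullet> w1 = a0 \<bullet> w1 + 1" "a1 \<bullet> w2 = a0 \<bullet> w2" "a2 \<bullet> w1 = a0 \<bullet> w1" "a2 \<bullet> w2 = a0 \<bullet> w2 + 1"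
    using w by (simp_all add: inner_diff_left)
  have v: "w1 \<bullet> a1 = w1 \<bullet> a0 + 1" "w2 \<bullet> a1 = w2 \<bullet> a0" "w1 \<bullet> a2 = w1 \<bullet> a0" "w2 \<bullet> a2 = w2 \<bullet> a0 + 1"
    using v by (simp_all add: inner_commute)
  show ?thesis
  proof (rule that[of n])
    show "n a \<bullet> a < n a \<bullet> x" if "a \<in> A" "x \<in> A - {a}" for a x
      using that unfolding A(1) by (auto simp: n v inner_add_left)
    show "n a \<bullet> x = n a \<bullet> y" if "a \<in> A" "x \<in> A - {a}" "y \<in> A - {a}" for a x y
      using that unfolding A(1) by (auto simp: n v inner_add_left)
    show "(\<Sum>a\<in>A. n a) = 0" unfolding A(1) using A(2-4) by (simp add: n)
  qed
qed

lemma orthogonal_imp_parallel: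
  assumes "n \<noteq> 0" "n \<bullet> x = 0" "n \<bullet> y = 0" shows "det2 x y = (0::real)"
proof -
  have x: "n $ 1 * x $ 1 + n $ 2 * x $ 2 = 0" and y: "n $ 1 * y $ 1 + n $ 2 * y $ 2 = 0"
    using assms(2,3) by (simp_all add: inner_vec_def sum_2)
  have "n $ 1 * det2 x y = (n $ 1 * x $ 1 + n $ 2 * x $ 2) * y $ 2 - (n $ 1 * y $ 1 + n $ 2 * y $ 2) * x $ 2"
       "n $ 2 * det2 x y = x $ 1 * (n $ 1 * y $ 1 + n $ 2 * y $ 2) - y $ 1 * (n $ 1 * x $ 1 + n $ 2 * x $ 2)"
    by (simp_all add: det2_def algebra_simps)
  hence "n $ 1 * det2 x y = 0" "n $ 2 * det2 x y = 0" unfolding x y by simp_all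
  thus ?thesis using assms(1) by (auto simp: vec_eq_iff forall_2)
qed

lemma perturb_strict_inequalities:
  fixes n t :: "'a::real_inner"
  assumes "finite X" "\<And>x. x \<in> X \<Longrightarrow> n \<bullet> x < 0"
  obtains e :: real where "e > 0" "\<And>x. x \<in> X \<Longrightarrow> (n + e *\<^sub>R t) \<bullet> x < 0"
proof -
  have "\<forall>\<^sub>F e in at_right (0::real). \<forall>x\<in>X. (n + e *\<^sub>R t) \<bullet> x < 0"
  proof (rule eventually_ball_finite[OF assms(1)], rule ballI)
    fix x assume "x \<in> X"
    have "((\<lambda>e::real. (n + e *\<^sub>R t) \<bullet> x) \<longlongrightarrow> (n + 0 *\<^sub>R t) \<bullet> x) (at_right 0)"
      by (intro tendsto_intros)
    thus "\<forall>\<^sub>F e in at_right (0::real). (n + e *\<^sub>R t) \<bullet> x < 0"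
      using order_tendstoD(2) assms(2)[OF \<open>x \<in> X\<close>] by fastforce
  qed
  hence "\<forall>\<^sub>F e in at_right (0::real). e > 0 \<and> (\<forall>x\<in>X. (n + e *\<^sub>R t) \<bullet> x < 0)"
    using eventually_at_right_less eventually_conj by blast
  then obtain e where "e > 0 \<and> (\<forall>x\<in>X. (n + e *\<^sub>R t) \<bullet> x < 0)"
    using eventually_happens'[OF trivial_limit_at_right_real] by blast
  thus ?thesis using that by blast
qed

lemma unique_maximizer:
  fixes n :: "'a::real_inner"
  assumes "finite B" "B \<noteq> {}" "inj_on (\<lambda>b. n \<bullet> b) B"
  obtains b where "b \<in> B" "\<And>y. y \<in> B - {b} \<Longrightarrow> n \<bullet> y < n \<bullet> b"
proof -
  have "Max ((\<lambda>b. n \<bullet> b) ` B) \<in> (\<lambda>b. n \<bullet> b) ` B" using assms by (intro Max_in) auto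
  then obtain b where b: "b \<in> B" "n \<bullet> b = Max ((\<lambda>b. n \<bullet> b) ` B)" by auto
  have le: "n \<bullet> y \<le> n \<bullet> b" if "y \<in> B" for y
    unfolding b(2) using assms(1) that by (intro Max_ge) auto
  have "n \<bullet> y < n \<bullet> b" if "y \<in> B - {b}" for y
    using le[of y] inj_onD[OF assms(3), of y b] b(1) that by force
  thus ?thesis using that b(1) by blast
qed

text \<open>
  A pair \<open>(a, b)\<close> gives a vertex \<open>a + b\<close> of the sum as soon as one linear functional has its unique
  maximum over \<open>A\<close> at \<open>a\<close> and its unique maximum over \<open>B\<close> at \<open>b\<close>; let \<open>V\<close> be the set of these
  pairs. As no edges are parallel, the outward normal of the edge of \<open>A\<close> opposite to \<open>a\<close> has a unique
  maximum \<open>\<beta> a\<close> over \<open>B\<close>, and tilting it slightly in either direction pairs both end points of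
  that edge with \<open>\<beta> a\<close>. Fix \<open>b \<in> B\<close> and let \<open>k\<close> be the number of \<open>a\<close> with \<open>\<beta> a = b\<close>. The \<open>k\<close> edges
  in question have \<open>k + 1\<close> end points altogether, because \<open>k\<close> is at most 2: the three normals of
  \<open>A\<close> add up to zero and therefore cannot all attain their maximum at \<open>b\<close>. For \<open>k = 0\<close> some point of \<open>A\<close>
  is still paired with the vertex \<open>b\<close>. Summing \<open>k + 1\<close> over \<open>B\<close> gives \<open>3 + 3 = 6\<close>.
\<close>
lemma six_vertices_if_no_parallel_edges:
  assumes A: "card A = 3" "\<not> (\<exists>v. v \<noteq> 0 \<and> on_line v A)"
    and B: "card B = 3" "\<not> (\<exists>v. v \<noteq> 0 \<and> on_line v B)"
    and npar: "\<And>a a' b b'. a \<in> A \<Longrightarrow> a' \<in> A \<Longrightarrow> a \<noteq> a' \<Longrightarrow> b \<in> B \<Longrightarrow> b' \<in> B \<Longrightarrow> b \<noteq> b' \<Longrightarrow>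
                 det2 (a - a') (b - b') \<noteq> 0"
  shows "6 \<le> card {v. v extreme_point_of (convex hull (A + B))}"
proof -
  have fin: "finite A" "finite B" and ne: "A \<noteq> {}" "B \<noteq> {}"
    using A(1) B(1) by (auto intro: card_ge_0_finite)
  obtain n where n: "\<And>a x. a \<in> A \<Longrightarrow> x \<in> A - {a} \<Longrightarrow> n a \<bullet> a < n a \<bullet> x"
    and n_eq: "\<And>a x y. a \<in> A \<Longrightarrow> x \<in> A - {a} \<Longrightarrow> y \<in> A - {a} \<Longrightarrow> n a \<bullet> x = n a \<bullet> y"
    and n_sum: "(\<Sum>a\<in>A. n a) = 0"
    by (rule outward_normals[OF A]) (rule that)
  obtain m where m: "\<And>b x. b \<in> B \<Longrightarrow> x \<in> B - {b} \<Longrightarrow> m b \<bullet> b < m b \<bullet> x"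
    and m_eq: "\<And>b x y. b \<in> B \<Longrightarrow> x \<in> B - {b} \<Longrightarrow> y \<in> B - {b} \<Longrightarrow> m b \<bullet> x = m b \<bullet> y"
    by (rule outward_normals[OF B]) (rule that)
  have third: "\<exists>x y. S = {s, x, y} \<and> x \<noteq> s \<and> y \<noteq> s \<and> x \<noteq> y" if "card S = 3" "s \<in> S" for S and s :: "real^2"
  proof -
    have "card (S - {s}) = 2" using that by simp
    then obtain x y where "S - {s} = {x, y}" "x \<noteq> y" unfolding card_2_iff by metis
    hence "S = {s, x, y} \<and> x \<noteq> s \<and> y \<noteq> s \<and> x \<noteq> y" using that(2) by blast
    thus ?thesis by blast
  qed
  have two: "\<exists>x y. x \<in> S - {s} \<and> y \<in> S - {s} \<and> x \<noteq> y" if S: "card S = 3" "s \<in> S" for S and s :: "real^2"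
    using third[OF S] by auto
  define V where "V = {(a, b). a \<in> A \<and> b \<in> B \<and>
     (\<exists>w. (\<forall>x\<in>A - {a}. w \<bullet> x < w \<bullet> a) \<and> (\<forall>y\<in>B - {b}. w \<bullet> y < w \<bullet> b))}"
  have V_le: "w \<bullet> x + w \<bullet> y < w \<bullet> a + w \<bullet> b"
    if "\<forall>x\<in>A - {a}. w \<bullet> x < w \<bullet> a" "\<forall>y\<in>B - {b}. w \<bullet> y < w \<bullet> b" "x \<in> A" "y \<in> B" "(x, y) \<noteq> (a, b)"
    for w :: "real^2" and a b x y
  proof (cases "x = a")
    case True
    thus ?thesis using that by auto
  next
    case False
    hence "w \<bullet> x < w \<bullet> a" using that by blast
    moreover have "w \<bullet> y \<le> w \<bullet> b" using that(2,4) by (cases "y = b") (auto intro: less_imp_le)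
    ultimately show ?thesis by simp
  qed
  have V_inj: "inj_on (\<lambda>(a, b). a + b) V"
  proof (rule inj_onI, clarify)
    fix a b a' b' assume ab: "(a, b) \<in> V" "(a', b') \<in> V" and eq: "a + b = a' + b'"
    then obtain w where w: "\<forall>x\<in>A - {a}. w \<bullet> x < w \<bullet> a" "\<forall>y\<in>B - {b}. w \<bullet> y < w \<bullet> b"
      unfolding V_def by blast
    have "w \<bullet> a + w \<bullet> b = w \<bullet> a' + w \<bullet> b'" using eq by (metis inner_add_right)
    moreover have "a' \<in> A" "b' \<in> B" using ab(2) unfolding V_def by auto
    ultimately show "a = a' \<and> b = b'" using V_le[OF w, of a' b'] by fastforce
  qed
  have V_ext: "(\<lambda>(a, b). a + b) ` V \<subseteq> {v. v extreme_point_of (convex hull (A + B))}"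
  proof clarify
    fix a b assume ab: "(a, b) \<in> V"
    then obtain w where w: "\<forall>x\<in>A - {a}. w \<bullet> x < w \<bullet> a" "\<forall>y\<in>B - {b}. w \<bullet> y < w \<bullet> b"
      unfolding V_def by blast
    show "(a + b) extreme_point_of (convex hull (A + B))"
    proof (rule exposed_extreme_point[where w = w])
      show "finite (A + B)" using fin by (rule finite_set_plus)
      show "a + b \<in> A + B" using ab unfolding V_def by (auto intro: set_plus_intro)
      fix z assume "z \<in> A + B - {a + b}"
      then obtain x y where "z = x + y" "x \<in> A" "y \<in> B" "(x, y) \<noteq> (a, b)" by (auto elim!: set_plus_elim)
      thus "w \<bullet> z < w \<bullet> (a + b)" using V_le[OF w] by (simp add: inner_add_right)
    qed
  qed
  have "finite {v. v extreme_point_of (convex hull (A + B))}"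
    using fin by (intro finite_subset[OF extreme_points_of_convex_hull]) (simp add: finite_set_plus)
  from card_mono[OF this V_ext] have card_V: "card V \<le> card {v. v extreme_point_of (convex hull (A + B))}"
    by (simp add: card_image[OF V_inj])
  have n_inj: "inj_on (\<lambda>b. n a \<bullet> b) B" if a: "a \<in> A" for a
  proof (rule inj_onI, rule ccontr)
    fix b b' assume b: "b \<in> B" "b' \<in> B" "n a \<bullet> b = n a \<bullet> b'" "b \<noteq> b'"
    obtain x y where xy: "x \<in> A - {a}" "y \<in> A - {a}" "x \<noteq> y" using two[OF A(1) a] by blast
    have "n a \<noteq> 0" using n[OF a xy(1)] by auto
    from orthogonal_imp_parallel[OF this, of "x - y" "b - b'"] n_eq[OF a xy(1,2)] b(3)
    have "det2 (x - y) (b - b') = 0" by (simp add: inner_diff_right)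
    thus False using npar[of x y b b'] xy b by blast
  qed
  have m_inj: "inj_on (\<lambda>a. - m b \<bullet> a) A" if b: "b \<in> B" for b
  proof (rule inj_onI, rule ccontr)
    fix a a' assume a: "a \<in> A" "a' \<in> A" "- m b \<bullet> a = - m b \<bullet> a'" "a \<noteq> a'"
    obtain x y where xy: "x \<in> B - {b}" "y \<in> B - {b}" "x \<noteq> y" using two[OF B(1) b] by blast
    have "m b \<noteq> 0" using m[OF b xy(1)] by auto
    from orthogonal_imp_parallel[OF this, of "a - a'" "x - y"] m_eq[OF b xy(1,2)] a(3)
    have "det2 (a - a') (x - y) = 0" by (simp add: inner_diff_right)
    thus False using npar[of a a' x y] xy a by blast
  qed
  have "\<exists>b. b \<in> B \<and> (\<forall>y\<in>B - {b}. n a \<bullet> y < n a \<bullet> b)" if "a \<in> A" for a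
    using unique_maximizer[OF fin(2) ne(2) n_inj[OF that]] by metis
  then obtain \<beta> where \<beta>: "\<And>a. a \<in> A \<Longrightarrow> \<beta> a \<in> B" "\<And>a y. a \<in> A \<Longrightarrow> y \<in> B - {\<beta> a} \<Longrightarrow> n a \<bullet> y < n a \<bullet> \<beta> a"
    by metis
  define fib where "fib b = {a. (a, b) \<in> V}" for b
  have fib_fin: "finite (fib b)" for b
    unfolding fib_def V_def by (rule finite_subset[OF _ fin(1)]) auto
  have edge: "A - {a} \<subseteq> fib (\<beta> a)" if a: "a \<in> A" for a
  proof
    fix a' assume a': "a' \<in> A - {a}"
    obtain a'' where a'': "A = {a, a', a''}" "a'' \<noteq> a" "a'' \<noteq> a'"
      using third[OF A(1) a] a' by auto
    \<comment> \<open>Tilting the edge normal towards \<open>t\<close> breaks the tie between \<open>a'\<close> and \<open>a''\<close> in favour of \<open>a'\<close>.\<close>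
    define t where "t = a' - a''"
    obtain e where e: "e > 0" "\<And>x. x \<in> insert (a - a') ((\<lambda>y. y - \<beta> a) ` (B - {\<beta> a})) \<Longrightarrow> (n a + e *\<^sub>R t) \<bullet> x < 0"
    proof (rule perturb_strict_inequalities[where n = "n a" and t = t and X = "insert (a - a') ((\<lambda>y. y - \<beta> a) ` (B - {\<beta> a}))"])
      show "finite (insert (a - a') ((\<lambda>y. y - \<beta> a) ` (B - {\<beta> a})))" using fin by simp
      show "n a \<bullet> x < 0" if "x \<in> insert (a - a') ((\<lambda>y. y - \<beta> a) ` (B - {\<beta> a}))" for x
        using that n[OF a a'] by (auto simp: inner_diff_right intro: \<beta>(2)[OF a])
    qed blast
    let ?w = "n a + e *\<^sub>R t"
    have "?w \<bullet> (a'' - a') < 0"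
    proof -
      have "?w \<bullet> (a'' - a') = e * (t \<bullet> (a'' - a'))"
        using n_eq[OF a, of a'' a'] a' a'' by (simp add: inner_add_left inner_diff_right right_diff_distrib)
      also have "t \<bullet> (a'' - a') = - (t \<bullet> t)" unfolding t_def by (simp add: inner_diff_right)
      finally show ?thesis using e(1) a''(3) unfolding t_def by (simp add: mult_pos_pos)
    qed
    hence "\<forall>x\<in>A - {a'}. ?w \<bullet> x < ?w \<bullet> a'"
      using e(2)[of "a - a'"] a'' by (auto simp: inner_diff_right)
    moreover have "\<forall>y\<in>B - {\<beta> a}. ?w \<bullet> y < ?w \<bullet> \<beta> a"
    proof
      fix y assume "y \<in> B - {\<beta> a}"
      with e(2)[of "y - \<beta> a"] show "?w \<bullet> y < ?w \<bullet> \<beta> a" by (auto simp: inner_diff_right)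
    qed
    ultimately show "a' \<in> fib (\<beta> a)" unfolding fib_def V_def using a' \<beta>(1)[OF a] by blast
  qed
  have vertex: "fib b \<noteq> {}" if b: "b \<in> B" for b
  proof -
    obtain a where "a \<in> A" "\<And>x. x \<in> A - {a} \<Longrightarrow> - m b \<bullet> x < - m b \<bullet> a"
      using unique_maximizer[OF fin(1) ne(1) m_inj[OF b]] by metis
    moreover have "- m b \<bullet> y < - m b \<bullet> b" if "y \<in> B - {b}" for y using m[OF b that] by simp
    ultimately have "(a, b) \<in> V" unfolding V_def using b by blast
    thus ?thesis unfolding fib_def by blast
  qed
  have nonconst: "\<exists>a\<in>A. \<beta> a \<noteq> b" if b: "b \<in> B" for b
  proof (rule ccontr)
    assume "\<not> ?thesis"
    hence const: "\<beta> a = b" if "a \<in> A" for a using that by blast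
    obtain y where y: "y \<in> B - {b}" using two[OF B(1) b] by blast
    have "(\<Sum>a\<in>A. n a \<bullet> y) < (\<Sum>a\<in>A. n a \<bullet> b)"
      by (rule sum_strict_mono[OF fin(1) ne(1)]) (use \<beta>(2) const y in auto)
    thus False by (simp add: n_sum flip: inner_sum_left)
  qed
  have fib_card: "card {a \<in> A. \<beta> a = b} + 1 \<le> card (fib b)" if b: "b \<in> B" for b
  proof (cases "\<exists>a\<in>A. \<beta> a = b")
    case False
    hence "{a \<in> A. \<beta> a = b} = {}" by blast
    moreover have "card (fib b) \<noteq> 0" using vertex[OF b] fib_fin by simp
    ultimately show ?thesis by (simp only: card.empty)
  next
    case True
    then obtain a where a: "a \<in> A" "\<beta> a = b" by blast
    obtain c where c: "c \<in> A" "\<beta> c \<noteq> b" using nonconst[OF b] by blast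
    with a obtain d where d: "A = {a, c, d}" "d \<noteq> a" "d \<noteq> c" "a \<noteq> c" using third[OF A(1) a(1)] by auto
    show ?thesis
    proof (cases "\<beta> d = b")
      case True
      have "{a \<in> A. \<beta> a = b} = {a, d}" using a c d True by auto
      moreover have "{a, c, d} \<subseteq> fib b" using edge[OF a(1)] edge[of d] a d True by auto
      ultimately show ?thesis using card_mono[OF fib_fin, of "{a, c, d}" b] d by auto
    next
      case False
      have "{a \<in> A. \<beta> a = b} = {a}" using a c d False by auto
      moreover have "{c, d} \<subseteq> fib b" using edge[OF a(1)] a d by auto
      ultimately show ?thesis using card_mono[OF fib_fin, of "{c, d}" b] d by auto
    qed
  qed
  have "V = (\<Union>b\<in>B. (\<lambda>a. (a, b)) ` fib b)" unfolding fib_def V_def by auto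
  also have "card \<dots> = (\<Sum>b\<in>B. card ((\<lambda>a. (a, b)) ` fib b))"
    by (rule card_UN_disjoint) (use fin fib_fin in auto)
  also have "\<dots> = (\<Sum>b\<in>B. card (fib b))" by (intro sum.cong refl card_image) (auto simp: inj_on_def)
  finally have "card V = (\<Sum>b\<in>B. card (fib b))" .
  moreover have "(\<Sum>b\<in>B. card {a \<in> A. \<beta> a = b} + 1) \<le> (\<Sum>b\<in>B. card (fib b))"
    by (intro sum_mono fib_card)
  moreover have "(\<Sum>b\<in>B. card {a \<in> A. \<beta> a = b} + 1) = 6"
  proof -
    have "(\<Sum>b\<in>B. card {a \<in> A. \<beta> a = b}) = (\<Sum>b\<in>B. \<Sum>a | a \<in> A \<and> \<beta> a = b. 1)" by simp
    also have "\<dots> = (\<Sum>a\<in>A. 1)" by (rule sum.group[OF fin]) (use \<beta>(1) in blast)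
    finally show ?thesis using A(1) B(1) unfolding sum.distrib by simp
  qed
  ultimately show ?thesis using card_V by simp
qed

section \<open>Upper bounds from the shape of the Newton polygon\<close>

lemma few_roots_at_most_five_vertices:
  assumes F: "has_type (3, 3) F" and P: "polygon l (newton_sum F)" "l \<le> 5"
  shows "few_roots 4 F"
proof -
  obtain f1 f2 where Feq: "F = (f1, f2)" by (cases F)
  have card3: "card (supp f1) = 3" "card (supp f2) = 3" using F Feq by (auto simp: has_type_def nomial_def)
  have F': "has_type (3, 3) (f2, f1)" using F Feq by (auto simp: has_type_def)
  have P2: "aff_dim (supp f1 + supp f2) = 2" "card {v. v extreme_point_of (convex hull (supp f1 + supp f2))} = l"
    using P(1) unfolding polygon_def newton_sum_eq_hull Feq by (simp_all add: aff_dim_convex_hull)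
  have nl: False if "v \<noteq> 0" "on_line v (supp f1)" "on_line v (supp f2)" for v
    using aff_dim_on_line[OF that(1) on_line_plus[OF that(2,3)]] P2(1) by simp
  consider (one) v where "v \<noteq> 0" "on_line v (supp f1)" | (two) v where "v \<noteq> 0" "on_line v (supp f2)"
    | (none) "\<not> (\<exists>v. v \<noteq> 0 \<and> on_line v (supp f1))" "\<not> (\<exists>v. v \<noteq> 0 \<and> on_line v (supp f2))" by blast
  thus ?thesis
  proof cases
    case one
    then obtain b b' where "b \<in> supp f2" "b' \<in> supp f2" "det2 v (b - b') \<noteq> 0"
      using nl unfolding on_line_def by blast
    with few_roots_one_collinear[OF one(1) F[unfolded Feq]] one(2) show ?thesis
      unfolding Feq on_line_def by blast
  next
    case two
    then obtain b b' where "b \<in> supp f1" "b' \<in> supp f1" "det2 v (b - b') \<noteq> 0"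
      using nl unfolding on_line_def by blast
    with few_roots_one_collinear[OF two(1) F'] two(2) have "few_roots 4 (f2, f1)"
      unfolding on_line_def by blast
    thus ?thesis unfolding Feq by (rule few_roots_swap)
  next
    case none
    have "\<exists>a a' b b'. a \<in> supp f1 \<and> a' \<in> supp f1 \<and> a \<noteq> a' \<and> b \<in> supp f2 \<and> b' \<in> supp f2 \<and> b \<noteq> b' \<and>
                 det2 (a - a') (b - b') = 0"
      using six_vertices_if_no_parallel_edges[OF card3(1) none(1) card3(2) none(2)] P2(2) P(2) by fastforce
    then obtain a a' b b' where ab: "a \<in> supp f1" "a' \<in> supp f1" "a \<noteq> a'" "b \<in> supp f2" "b' \<in> supp f2" "b \<noteq> b'"
      "det2 (a' - a) (b' - b) = 0" by (metis (no_types, lifting))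
    obtain a'' where a'': "supp f1 = {a, a', a''}" "det2 (a' - a) (a'' - a) \<noteq> 0"
      using spread_triple[OF card3(1) none(1) ab(1-3)] by metis
    obtain b'' where b'': "supp f2 = {b, b', b''}" "det2 (b' - b) (b'' - b) \<noteq> 0"
      using spread_triple[OF card3(2) none(2) ab(4-6)] by metis
    have "a' - a \<noteq> 0" using ab(3) by simp
    then obtain \<mu> where "b' - b = \<mu> *\<^sub>R (a' - a)" using det2_zero_imp_scaled[OF _ ab(7)] by blast
    from few_roots_parallel_edge(1)[OF F[unfolded Feq] a''(1) b''(1) a''(2) b''(2) this]
    show ?thesis unfolding Feq .
  qed
qed

lemma few_roots_triangle:
  assumes F: "has_type (3, 3) F" and P: "polygon 3 (newton_sum F)"
  shows "few_roots 2 F"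
proof -
  obtain f1 f2 where Feq: "F = (f1, f2)" by (cases F)
  have card3: "card (supp f1) = 3" "card (supp f2) = 3" using F Feq by (auto simp: has_type_def nomial_def)
  have P': "polygon 3 (convex hull (supp f1 + supp f2))" using P unfolding newton_sum_eq_hull Feq by simp
  from triangle_sum_homothetic[OF card3 P'] obtain a0 a1 a2 b0 b1 b2 \<mu> where
    "supp f1 = {a0, a1, a2}" "supp f2 = {b0, b1, b2}"
    "det2 (a1 - a0) (a2 - a0) \<noteq> 0" "det2 (b1 - b0) (b2 - b0) \<noteq> 0"
    "b1 - b0 = \<mu> *\<^sub>R (a1 - a0)" "b2 - b0 = \<mu> *\<^sub>R (a2 - a0)" by metis
  from few_roots_parallel_edge(2)[OF F[unfolded Feq] this] show ?thesis unfolding Feq .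
qed

lemma no_isolated_root_segment:
  assumes F: "has_type (3, 3) F" and P: "line_segment (newton_sum F)"
  shows "isolated_pos_roots F = {}"
proof -
  obtain p q where pq: "p \<noteq> q" "convex hull (supp (fst F) + supp (snd F)) = closed_segment p q"
    using P unfolding line_segment_def newton_sum_eq_hull by blast
  have ne: "supp (fst F) \<noteq> {}" "supp (snd F) \<noteq> {}" using F by (auto simp: has_type_def nomial_def)
  have seg: "det2 (q - p) (x - y) = 0" if xy: "x \<in> supp (fst F) + supp (snd F)" "y \<in> supp (fst F) + supp (snd F)" for x y
  proof -
    have "x \<in> closed_segment p q" "y \<in> closed_segment p q" using xy pq(2) hull_inc by metis+
    then obtain s t where xy: "x = (1 - s) *\<^sub>R p + s *\<^sub>R q" "y = (1 - t) *\<^sub>R p + t *\<^sub>R q"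
      unfolding closed_segment_def by blast
    show ?thesis unfolding xy by (simp add: det2_def algebra_simps)
  qed
  show ?thesis
  proof (rule no_isolated_root_parallel[of "q - p"])
    show "q - p \<noteq> 0" using pq(1) by simp
    show "det2 (q - p) (a - a') = 0" if "a \<in> supp (fst F)" "a' \<in> supp (fst F)" for a a'
    proof -
      obtain b where "b \<in> supp (snd F)" using ne by blast
      with seg[of "a + b" "a' + b"] that show ?thesis by (simp add: set_plus_intro)
    qed
    show "det2 (q - p) (b - b') = 0" if "b \<in> supp (snd F)" "b' \<in> supp (snd F)" for b b'
    proof -
      obtain a where "a \<in> supp (fst F)" using ne by blast
      with seg[of "a + b" "a + b'"] that show ?thesis by (simp add: set_plus_intro)
    qed
  qed
qed

section \<open>Systems attaining the bounds\<close>

definition pt :: "real \<Rightarrow> real \<Rightarrow> real^2"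
  where "pt x y = vector [x, y]"

lemma pt_simps [simp]:
  "pt x y $ 1 = x" "pt x y $ 2 = y" "pt x y + pt z w = pt (x + z) (y + w)" "pt x y - pt z w = pt (x - z) (y - w)"
  "c *\<^sub>R pt x y = pt (c * x) (c * y)" "pt x y \<bullet> pt z w = x * z + y * w"
  "pt x y = pt z w \<longleftrightarrow> x = z \<and> y = w"
  by (auto simp: pt_def vec_eq_iff forall_2 inner_vec_def sum_2)

lemma pt_eta: "x = pt (x $ 1) (x $ 2)"
  by (simp add: vec_eq_iff forall_2)

definition trinomial :: "real \<Rightarrow> real^2 \<Rightarrow> real \<Rightarrow> real^2 \<Rightarrow> real \<Rightarrow> real^2 \<Rightarrow> 2 fewnomial"
  where "trinomial c0 a0 c1 a1 c2 a2 =
    Poly_Mapping.single a0 c0 + Poly_Mapping.single a1 c1 + Poly_Mapping.single a2 c2"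

lemma trinomial:
  assumes "a0 \<noteq> a1" "a0 \<noteq> a2" "a1 \<noteq> a2" "c0 \<noteq> 0" "c1 \<noteq> 0" "c2 \<noteq> 0"
  shows supp_trinomial: "supp (trinomial c0 a0 c1 a1 c2 a2) = {a0, a1, a2}"
    and eval_trinomial: "fewnomial_eval (trinomial c0 a0 c1 a1 c2 a2) x =
      c0 * monom_at a0 x + c1 * monom_at a1 x + c2 * monom_at a2 x"
    and nomial_trinomial: "nomial 3 (trinomial c0 a0 c1 a1 c2 a2)"
proof -
  have cf: "cf (trinomial c0 a0 c1 a1 c2 a2) a =
      (if a = a0 then c0 else if a = a1 then c1 else if a = a2 then c2 else 0)" for a
    using assms unfolding trinomial_def by (auto simp: Poly_Mapping.lookup_add Poly_Mapping.lookup_single when_def)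
  show supp: "supp (trinomial c0 a0 c1 a1 c2 a2) = {a0, a1, a2}"
    using assms by (auto simp: Poly_Mapping.in_keys_iff cf split: if_splits)
  show "fewnomial_eval (trinomial c0 a0 c1 a1 c2 a2) x =
      c0 * monom_at a0 x + c1 * monom_at a1 x + c2 * monom_at a2 x"
    unfolding fewnomial_eval_def supp using assms by (simp add: cf)
  show "nomial 3 (trinomial c0 a0 c1 a1 c2 a2)"
    unfolding nomial_def supp using assms by simp
qed

lemma monom_at_pt:
  assumes "x > 0" "y > 0"
  shows "monom_at (pt 0 0) (pt x y) = 1" "monom_at (pt 1 0) (pt x y) = x" "monom_at (pt 0 1) (pt x y) = y"
    "monom_at (pt 2 0) (pt x y) = x\<^sup>2" "monom_at (pt 0 2) (pt x y) = y\<^sup>2"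
    "monom_at (pt 1 1) (pt x y) = x * y" "monom_at (pt 2 2) (pt x y) = (x * y)\<^sup>2"
  using assms by (simp_all add: monom_at_def UNIV_2 powr_numeral power_mult_distrib)

lemma pos_roots_pt:
  "pos_roots F = {pt x y | x y. x > 0 \<and> y > 0 \<and>
     fewnomial_eval (fst F) (pt x y) = 0 \<and> fewnomial_eval (snd F) (pt x y) = 0}"
proof -
  have "z \<in> pos_orthant \<longleftrightarrow> (\<exists>x y. z = pt x y \<and> x > 0 \<and> y > 0)" for z
    unfolding pos_orthant_def mem_Collect_eq forall_2 by (metis pt_eta pt_simps(1,2))
  thus ?thesis unfolding pos_roots_def by auto
qed

text \<open>
  The vertices of the hull of an explicit finite set are certified by exposing functionals, and
  the other points are seen not to be vertices by writing them as midpoints.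
\<close>
lemma polygon_hull:
  assumes S: "finite S" and V: "V \<subseteq> S" "card V = l"
    and exposed: "\<And>v. v \<in> V \<Longrightarrow> \<exists>w. \<forall>x\<in>S - {v}. w \<bullet> x < w \<bullet> v"
    and mid: "\<And>x. x \<in> S - V \<Longrightarrow> \<exists>y\<in>S. \<exists>z\<in>S. y \<noteq> z \<and> x = (1/2) *\<^sub>R (y + z)"
    and spread: "x \<in> S" "y \<in> S" "z \<in> S" "det2 (y - x) (z - x) \<noteq> 0"
  shows "polygon l (convex hull S)"
proof -
  have "v \<in> V" if v: "v extreme_point_of (convex hull S)" for v
  proof (rule ccontr)
    assume "v \<notin> V"
    moreover have "v \<in> S" using extreme_point_of_convex_hull[OF v] .
    ultimately obtain y z where yz: "y \<in> S" "z \<in> S" "y \<noteq> z" "v = (1/2) *\<^sub>R (y + z)" using mid by blast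
    have "v = midpoint y z" unfolding yz(4) midpoint_def by simp
    hence "v \<in> open_segment y z" using yz(3) by (simp add: midpoint_in_open_segment)
    thus False using v yz(1,2) hull_inc unfolding extreme_point_of_def by metis
  qed
  moreover have "v extreme_point_of (convex hull S)" if "v \<in> V" for v
    using exposed[OF that] exposed_extreme_point[OF S, of v] V(1) that by blast
  ultimately have ext: "{v. v extreme_point_of (convex hull S)} = V" by blast
  have "\<not> aff_dim S \<le> 1"
  proof
    assume "aff_dim S \<le> 1"
    then obtain u where u: "\<And>x y. x \<in> S \<Longrightarrow> y \<in> S \<Longrightarrow> \<exists>c. x - y = c *\<^sub>R u"
      unfolding collinear_aff_dim[symmetric] collinear_def by blast
    obtain c d where cd: "y - x = c *\<^sub>R u" "z - x = d *\<^sub>R u" using u spread(1-3) by metis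
    show False using spread(4) unfolding cd by (simp add: det2_def)
  qed
  moreover have "aff_dim S \<le> 2" using aff_dim_le_DIM[of S] by simp
  ultimately have "aff_dim (convex hull S) = 2" by (simp add: aff_dim_convex_hull)
  thus ?thesis unfolding polygon_def ext using V(2) S by (simp add: polytope_convex_hull)
qed

lemma segment_example:
  "\<exists>F. has_type (3, 3) F \<and> line_segment (newton_sum F)"
proof -
  define f where "f = trinomial 1 (pt 0 0) 1 (pt 1 0) 1 (pt 2 0)"
  have supp: "supp f = {pt 0 0, pt 1 0, pt 2 0}" unfolding f_def by (rule supp_trinomial) auto
  have "nomial 3 f" unfolding f_def by (rule nomial_trinomial) auto
  hence type: "has_type (3, 3) (f, f)" by (simp add: has_type_def)
  let ?S = "supp f + supp f"
  have S: "?S = {pt 0 0, pt 1 0, pt 2 0, pt 3 0, pt 4 0}"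
    unfolding supp by (auto simp: set_plus_def)
  have "?S \<subseteq> closed_segment (pt 0 0) (pt 4 0)"
  proof -
    have "pt t 0 \<in> closed_segment (pt 0 0) (pt 4 0)" if "0 \<le> t" "t \<le> 4" for t
      unfolding closed_segment_def using that by (auto intro!: exI[of _ "t / 4"])
    thus ?thesis unfolding S by auto
  qed
  hence "convex hull ?S \<subseteq> closed_segment (pt 0 0) (pt 4 0)" by (simp add: hull_minimal)
  moreover have "closed_segment (pt 0 0) (pt 4 0) \<subseteq> convex hull ?S"
    unfolding segment_convex_hull by (rule hull_mono) (auto simp: S)
  ultimately have "newton_sum (f, f) = closed_segment (pt 0 0) (pt 4 0)"
    unfolding newton_sum_eq_hull by simp
  moreover have "pt 0 0 \<noteq> pt 4 0" by simp
  ultimately show ?thesis using type unfolding line_segment_def by blast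
qed

text \<open>
  The line \<open>x + y = 3\<close> meets the circle \<open>x\<^sup>2 + y\<^sup>2 = 5\<close> in \<open>(1, 2)\<close> and \<open>(2, 1)\<close>.
\<close>
lemma triangle_example:
  "\<exists>F. has_type (3, 3) F \<and> polygon 3 (newton_sum F) \<and> card (isolated_pos_roots F) = 2"
proof -
  define f where "f = trinomial (-3) (pt 0 0) 1 (pt 1 0) 1 (pt 0 1)"
  define g where "g = trinomial (-5) (pt 0 0) 1 (pt 2 0) 1 (pt 0 2)"
  have supp: "supp f = {pt 0 0, pt 1 0, pt 0 1}" "supp g = {pt 0 0, pt 2 0, pt 0 2}"
    unfolding f_def g_def by (rule supp_trinomial; simp)+
  have "nomial 3 f" "nomial 3 g" unfolding f_def g_def by (rule nomial_trinomial; simp)+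
  hence type: "has_type (3, 3) (f, g)" by (simp add: has_type_def)
  let ?S = "supp f + supp g"
  have S: "?S = {pt 0 0, pt 2 0, pt 0 2, pt 1 0, pt 3 0, pt 1 2, pt 0 1, pt 2 1, pt 0 3}"
    unfolding supp by (auto simp: set_plus_def)
  have "polygon 3 (newton_sum (f, g))"
    unfolding newton_sum_eq_hull fst_conv snd_conv
  proof (rule polygon_hull[where V = "{pt 0 0, pt 3 0, pt 0 3}"])
    show "\<exists>w. \<forall>x\<in>?S - {v}. w \<bullet> x < w \<bullet> v" if "v \<in> {pt 0 0, pt 3 0, pt 0 3}" for v
    proof -
      have "\<forall>x\<in>?S - {pt 0 0}. pt (-1) (-1) \<bullet> x < pt (-1) (-1) \<bullet> pt 0 0"
        "\<forall>x\<in>?S - {pt 3 0}. pt 1 0 \<bullet> x < pt 1 0 \<bullet> pt 3 0"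
        "\<forall>x\<in>?S - {pt 0 3}. pt 0 1 \<bullet> x < pt 0 1 \<bullet> pt 0 3"
        unfolding S by auto
      thus ?thesis using that by blast
    qed
    show "\<exists>y\<in>?S. \<exists>z\<in>?S. y \<noteq> z \<and> x = (1/2) *\<^sub>R (y + z)" if "x \<in> ?S - {pt 0 0, pt 3 0, pt 0 3}" for x
      using that unfolding S by auto
    show "pt 0 0 \<in> ?S" "pt 1 0 \<in> ?S" "pt 0 1 \<in> ?S" "det2 (pt 1 0 - pt 0 0) (pt 0 1 - pt 0 0) \<noteq> 0"
      unfolding S by (auto simp: det2_def)
  qed (auto simp: S)
  moreover have "pos_roots (f, g) = {pt 1 2, pt 2 1}"
  proof -
    have "fewnomial_eval f (pt x y) = 0 \<and> fewnomial_eval g (pt x y) = 0 \<longleftrightarrow>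
        x = 1 \<and> y = 2 \<or> x = 2 \<and> y = 1" if "x > 0" "y > 0" for x y
    proof -
      have eval: "fewnomial_eval f (pt x y) = x + y - 3" "fewnomial_eval g (pt x y) = x\<^sup>2 + y\<^sup>2 - 5"
        unfolding f_def g_def by (simp_all add: eval_trinomial monom_at_pt[OF that])
      have "fewnomial_eval f (pt x y) = 0 \<and> fewnomial_eval g (pt x y) = 0 \<longleftrightarrow>
          y = 3 - x \<and> x\<^sup>2 + (3 - x)\<^sup>2 - 5 = 0"
        unfolding eval by (cases "y = 3 - x") auto
      also have "x\<^sup>2 + (3 - x)\<^sup>2 - 5 = 2 * ((x - 1) * (x - 2))"
        by (simp add: power2_eq_square algebra_simps)
      finally show ?thesis by auto
    qed
    thus ?thesis unfolding pos_roots_pt by fastforce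
  qed
  ultimately show ?thesis using type isolated_if_finite[of "(f, g)"] by (intro exI[of _ "(f, g)"]) auto
qed

text \<open>
  The equations are \<open>(x - 1) (x - 2) = 0\<close> and \<open>(y - 1) (y - 2) = 0\<close>.
\<close>
lemma parallelogram_example:
  "\<exists>F. has_type (3, 3) F \<and> polygon 4 (newton_sum F) \<and> card (isolated_pos_roots F) = 4"
proof -
  define f where "f = trinomial 2 (pt 0 0) (-3) (pt 1 0) 1 (pt 2 0)"
  define g where "g = trinomial 2 (pt 0 0) (-3) (pt 0 1) 1 (pt 0 2)"
  have supp: "supp f = {pt 0 0, pt 1 0, pt 2 0}" "supp g = {pt 0 0, pt 0 1, pt 0 2}"
    unfolding f_def g_def by (rule supp_trinomial; simp)+
  have "nomial 3 f" "nomial 3 g" unfolding f_def g_def by (rule nomial_trinomial; simp)+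
  hence type: "has_type (3, 3) (f, g)" by (simp add: has_type_def)
  let ?S = "supp f + supp g"
  have S: "?S = {pt 0 0, pt 0 1, pt 0 2, pt 1 0, pt 1 1, pt 1 2, pt 2 0, pt 2 1, pt 2 2}"
    unfolding supp by (auto simp: set_plus_def)
  have "polygon 4 (newton_sum (f, g))"
    unfolding newton_sum_eq_hull fst_conv snd_conv
  proof (rule polygon_hull[where V = "{pt 0 0, pt 0 2, pt 2 0, pt 2 2}"])
    show "\<exists>w. \<forall>x\<in>?S - {v}. w \<bullet> x < w \<bullet> v" if "v \<in> {pt 0 0, pt 0 2, pt 2 0, pt 2 2}" for v
    proof -
      have "\<forall>x\<in>?S - {pt 0 0}. pt (-1) (-1) \<bullet> x < pt (-1) (-1) \<bullet> pt 0 0"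
        "\<forall>x\<in>?S - {pt 0 2}. pt (-1) 1 \<bullet> x < pt (-1) 1 \<bullet> pt 0 2"
        "\<forall>x\<in>?S - {pt 2 0}. pt 1 (-1) \<bullet> x < pt 1 (-1) \<bullet> pt 2 0"
        "\<forall>x\<in>?S - {pt 2 2}. pt 1 1 \<bullet> x < pt 1 1 \<bullet> pt 2 2"
        unfolding S by auto
      thus ?thesis using that by blast
    qed
    show "\<exists>y\<in>?S. \<exists>z\<in>?S. y \<noteq> z \<and> x = (1/2) *\<^sub>R (y + z)"
      if "x \<in> ?S - {pt 0 0, pt 0 2, pt 2 0, pt 2 2}" for x
      using that unfolding S by auto
    show "pt 0 0 \<in> ?S" "pt 1 0 \<in> ?S" "pt 0 1 \<in> ?S" "det2 (pt 1 0 - pt 0 0) (pt 0 1 - pt 0 0) \<noteq> 0"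
      unfolding S by (auto simp: det2_def)
  qed (auto simp: S)
  moreover have "pos_roots (f, g) = {pt 1 1, pt 1 2, pt 2 1, pt 2 2}"
  proof -
    have "fewnomial_eval f (pt x y) = 0 \<and> fewnomial_eval g (pt x y) = 0 \<longleftrightarrow>
        (x = 1 \<or> x = 2) \<and> (y = 1 \<or> y = 2)" if "x > 0" "y > 0" for x y
    proof -
      have "fewnomial_eval f (pt x y) = (x - 1) * (x - 2)" "fewnomial_eval g (pt x y) = (y - 1) * (y - 2)"
        unfolding f_def g_def by (simp_all add: eval_trinomial monom_at_pt[OF that] power2_eq_square algebra_simps)
      thus ?thesis by auto
    qed
    thus ?thesis unfolding pos_roots_pt by fastforce
  qed
  ultimately show ?thesis using type isolated_if_finite[of "(f, g)"] by (intro exI[of _ "(f, g)"]) auto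
qed

text \<open>
  The system \<open>(x y - 6) (x y - 10) = 0\<close>, \<open>x + y = 7\<close> asks for two numbers with sum 7 and product
  6 or 10. The first Newton polytope is a diagonal segment, not parallel to any edge of the second.
\<close>
lemma pentagon_example:
  "\<exists>F. has_type (3, 3) F \<and> polygon 5 (newton_sum F) \<and> card (isolated_pos_roots F) = 4"
proof -
  define f where "f = trinomial 60 (pt 0 0) (-16) (pt 1 1) 1 (pt 2 2)"
  define g where "g = trinomial (-7) (pt 0 0) 1 (pt 1 0) 1 (pt 0 1)"
  have supp: "supp f = {pt 0 0, pt 1 1, pt 2 2}" "supp g = {pt 0 0, pt 1 0, pt 0 1}"
    unfolding f_def g_def by (rule supp_trinomial; simp)+
  have "nomial 3 f" "nomial 3 g" unfolding f_def g_def by (rule nomial_trinomial; simp)+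
  hence type: "has_type (3, 3) (f, g)" by (simp add: has_type_def)
  let ?S = "supp f + supp g"
  let ?V = "{pt 0 0, pt 1 0, pt 0 1, pt 3 2, pt 2 3}"
  have S: "?S = {pt 0 0, pt 1 0, pt 0 1, pt 1 1, pt 2 1, pt 1 2, pt 2 2, pt 3 2, pt 2 3}"
    unfolding supp by (auto simp: set_plus_def)
  have "polygon 5 (newton_sum (f, g))"
    unfolding newton_sum_eq_hull fst_conv snd_conv
  proof (rule polygon_hull[where V = ?V])
    show "\<exists>w. \<forall>x\<in>?S - {v}. w \<bullet> x < w \<bullet> v" if "v \<in> ?V" for v
    proof -
      have "\<forall>x\<in>?S - {pt 0 0}. pt (-1) (-1) \<bullet> x < pt (-1) (-1) \<bullet> pt 0 0"
        "\<forall>x\<in>?S - {pt 1 0}. pt 2 (-3) \<bullet> x < pt 2 (-3) \<bullet> pt 1 0"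
        "\<forall>x\<in>?S - {pt 0 1}. pt (-3) 2 \<bullet> x < pt (-3) 2 \<bullet> pt 0 1"
        "\<forall>x\<in>?S - {pt 3 2}. pt 2 1 \<bullet> x < pt 2 1 \<bullet> pt 3 2"
        "\<forall>x\<in>?S - {pt 2 3}. pt 1 2 \<bullet> x < pt 1 2 \<bullet> pt 2 3"
        unfolding S by auto
      thus ?thesis using that by blast
    qed
    show "\<exists>y\<in>?S. \<exists>z\<in>?S. y \<noteq> z \<and> x = (1/2) *\<^sub>R (y + z)" if "x \<in> ?S - ?V" for x
      using that unfolding S by auto
    show "pt 0 0 \<in> ?S" "pt 1 0 \<in> ?S" "pt 0 1 \<in> ?S" "det2 (pt 1 0 - pt 0 0) (pt 0 1 - pt 0 0) \<noteq> 0"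
      unfolding S by (auto simp: det2_def)
  qed (auto simp: S)
  moreover have "pos_roots (f, g) = {pt 1 6, pt 6 1, pt 2 5, pt 5 2}"
  proof -
    have "fewnomial_eval f (pt x y) = 0 \<and> fewnomial_eval g (pt x y) = 0 \<longleftrightarrow>
        x = 1 \<and> y = 6 \<or> x = 6 \<and> y = 1 \<or> x = 2 \<and> y = 5 \<or> x = 5 \<and> y = 2" if "x > 0" "y > 0" for x y
    proof -
      have eval: "fewnomial_eval f (pt x y) = (x * y - 6) * (x * y - 10)" "fewnomial_eval g (pt x y) = x + y - 7"
        unfolding f_def g_def by (simp_all add: eval_trinomial monom_at_pt[OF that] power2_eq_square algebra_simps)
      have "fewnomial_eval f (pt x y) = 0 \<and> fewnomial_eval g (pt x y) = 0 \<longleftrightarrow>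
          y = 7 - x \<and> (x * (7 - x) - 6) * (x * (7 - x) - 10) = 0"
        unfolding eval by (cases "y = 7 - x") auto
      also have "(x * (7 - x) - 6) * (x * (7 - x) - 10) = (x - 1) * (x - 6) * ((x - 2) * (x - 5))"
        by (simp add: algebra_simps)
      finally show ?thesis by auto
    qed
    thus ?thesis unfolding pos_roots_pt by fastforce
  qed
  ultimately show ?thesis using type isolated_if_finite[of "(f, g)"] by (intro exI[of _ "(f, g)"]) auto
qed

theorem corollary3:
  shows "max_isolated_pos_roots {F. has_type (3, 3) F \<and> line_segment (newton_sum F)} 0 \<and>
         max_isolated_pos_roots {F. has_type (3, 3) F \<and> polygon 3 (newton_sum F)} 2 \<and>
         (\<forall>l \<in> {4, 5}. max_isolated_pos_roots {F. has_type (3, 3) F \<and> polygon l (newton_sum F)} 4)"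
proof (intro conjI ballI)
  show "max_isolated_pos_roots {F. has_type (3, 3) F \<and> line_segment (newton_sum F)} 0"
    unfolding max_isolated_pos_roots_def
    using segment_example no_isolated_root_segment by fastforce
  show "max_isolated_pos_roots {F. has_type (3, 3) F \<and> polygon 3 (newton_sum F)} 2"
    unfolding max_isolated_pos_roots_def
    using triangle_example few_roots_isolated[OF few_roots_triangle] by blast
  show "max_isolated_pos_roots {F. has_type (3, 3) F \<and> polygon l (newton_sum F)} 4" if "l \<in> {4, 5}" for l
    unfolding max_isolated_pos_roots_def
    using that parallelogram_example pentagon_example few_roots_isolated[OF few_roots_at_most_five_vertices, of _ l]
    by auto
qed

end
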